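(* The $\mathcal P$-map $(\Theta,\chi,\Lambda,\vartheta,\kappa,\ell)\in\mathfrak X_{\mathcal P}\times\mathbb T^n\mapsto (y_{\mathcal P},x_{\mathcal P})\in\mathbb R^{3n}\times\mathbb R^{3n}$ preserves the standard 2-form: $$\sum_{j=1}^n dy_{\mathcal P}^{(j)}\wedge dx_{\mathcal P}^{(j)}=\sum_{i=1}^n\big(d\Theta_{i-1}\wedge d\vartheta_{i-1}+d\chi_{i-1}\wedge d\kappa_{i-1}+d\Lambda_i\wedge d\ell_i\big).$$
   Context: Fix positive mass parameters $\mathfrak m_1,\ldots,\mathfrak m_n,\mathfrak M_1,\ldots,\mathfrak M_n$; $\mathbb T=\mathbb R/2\pi\mathbb Z$; $k^{(1)},k^{(2)},k^{(3)}$ is the standard basis of $\mathbb R^3$; $\mathcal R_1(\theta),\mathcal R_3(\theta)$ are the rotation matrices by angle $\theta$ about the first and third axis, $\mathcal R_1(\theta)=\begin{pmatrix}1&0&0\\0&\cos\theta&-\sin\theta\\0&\sin\theta&\cos\theta\end{pmatrix}$, $\mathcal R_3(\theta)=\begin{pmatrix}\cos\theta&-\sin\theta&0\\ \sin\theta&\cos\theta&0\\0&0&1\end{pmatrix}$. Let $\mathfrak X_{\mathcal P}\subset\mathbb R^n\times\mathbb R_+^n\times\mathbb R_+^n\times\mathbb T^n\times\mathbb T^n$ be the set of $(\Theta,\chi,\Lambda,\vartheta,\kappa)$, with $\Theta=(\Theta_0,\ldots,\Theta_{n-1})$, $\chi=(\chi_0,\ldots,\chi_{n-1})$, $\Lambda=(\Lambda_1,\ldots,\Lambda_n)$,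 $\vartheta=(\vartheta_0,\ldots,\vartheta_{n-1})$, $\kappa=(\kappa_0,\ldots,\kappa_{n-1})$, such that $|\Theta_0|<\chi_0$, $0<\chi_{n-1}<\Lambda_n$ and, for $i=1,\ldots,n-1$, $|\Theta_i|<\min(\chi_{i-1},\chi_i)$, $(\chi_{i-1}-\chi_i,\vartheta_i)\ne(0,\pi)$ and $\sqrt{\chi_{i-1}^2+\chi_i^2-2\Theta_i^2+2\sqrt{(\chi_i^2-\Theta_i^2)(\chi_{i-1}^2-\Theta_i^2)}\cos\vartheta_i}<\Lambda_i$. For a point of $\mathfrak X_{\mathcal P}$ put $\Theta_n:=0$, $\chi_n:=0$, define $\iota_j,\mathrm i_j\in(0,\pi)$ by $\cos\iota_j=\Theta_{j-1}/\chi_{j-1}$, $\cos\mathrm i_j=\Theta_j/\chi_{j-1}$ and set $\mathrm T_j=\mathcal R_3(\vartheta_{j-1})\mathcal R_1(\iota_j)$, $\mathrm S_j=\mathcal R_3(\kappa_{j-1})\mathcal R_1(\mathrm i_j)$, $1\le j\le n$. Let $$\mathrm C^{(j)}_{\mathcal P}=\mathrm T_1\mathrm S_1\cdots\mathrm T_{j-1}\mathrm S_{j-1}\mathrm T_j\big(\chi_{j-1}k^{(3)}-\chi_j\mathrm S_j\mathrm T_{j+1}k^{(3)}\big)$$ (the second term being absent for $j=n$), and $$a_j=\frac1{\mathfrak M_j}\Big(\frac{\Lambda_j}{\mathfrak m_j}\Big)^2,\quad e_j=\sqrt{1-\frac{\|\mathrm C^{(j)}_{\mathcal P}\|^2}{\Lambda_j^2}},\quad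 N^{(j)}=\frac{\mathrm C^{(j)}_{\mathcal P}}{\|\mathrm C^{(j)}_{\mathcal P}\|},\quad P^{(j)}=\mathrm T_1\mathrm S_1\cdots\mathrm T_j\mathrm S_jk^{(3)},\quad Q^{(j)}=N^{(j)}\times P^{(j)}.$$ The $\mathcal P$-map (perihelia reduction) is defined, for $\ell=(\ell_1,\ldots,\ell_n)\in\mathbb T^n$, by placing the $j$-th body on the ellipse with semi-major axis $a_j$, eccentricity $e_j$, normal direction $N^{(j)}$, perihelion direction $P^{(j)}$, with mean anomaly $\ell_j$: with $\zeta_j$ the solution of $\zeta_j-e_j\sin\zeta_j=\ell_j$, $$x^{(j)}_{\mathcal P}=a_j(\cos\zeta_j-e_j)P^{(j)}+a_j\sqrt{1-e_j^2}\,\sin\zeta_j\,Q^{(j)},$$ $$y^{(j)}_{\mathcal P}=-\mathfrak m_j\sqrt{\frac{\mathfrak M_j}{a_j}}\frac{\sin\zeta_j}{1-e_j\cos\zeta_j}P^{(j)}+\mathfrak m_j\sqrt{\frac{\mathfrak M_j(1-e_j^2)}{a_j}}\frac{\cos\zeta_j}{1-e_j\cos\zeta_j}Q^{(j)}.$$ Here $dy^{(j)}\wedge dx^{(j)}=\sum_{k=1}^3dy^{(j)}_k\wedge dx^{(j)}_k$. *)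

theory Defs
  imports "HOL-Analysis.Analysis"
begin

text \<open>
  The index type \<open>'n\<close> serves only to make \<open>\<real>\<^sup>n\<close> a Euclidean space, with \<open>n = CARD('n)\<close>. The
  coordinates are numbered \<open>0, \<dots>, n - 1\<close> through the library bijection \<open>from_nat_into UNIV\<close>
  between \<open>{..<CARD('n)}\<close> and \<open>'n\<close>; \<open>entry v i\<close> is meaningful for \<open>i < CARD('n)\<close> only.
\<close>

definition entry :: "'a ^ 'n::finite \<Rightarrow> nat \<Rightarrow> 'a" where
  "entry v i = v $ from_nat_into UNIV i"

text \<open>
  Points are tuples \<open>(\<Theta>, \<chi>, \<Lambda>, \<vartheta>, \<kappa>, \<ell>)\<close>. The angles \<open>\<vartheta>, \<kappa>, \<ell>\<close> are real lifts of points of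
  \<open>(\<real>/2\<pi>\<int>)\<^sup>n\<close>; the lemmas \<open>P_dom_torus\<close> and \<open>P_map_torus\<close> below show that the domain and the map
  only depend on the angles modulo \<open>2\<pi>\<close>.
\<close>

type_synonym 'n point =
  "(real ^ 'n) \<times> (real ^ 'n) \<times> (real ^ 'n) \<times> (real ^ 'n) \<times> (real ^ 'n) \<times> (real ^ 'n)"

definition Theta :: "nat \<Rightarrow> 'n::finite point \<Rightarrow> real" where
  "Theta i = (\<lambda>(th, ch, la, vt, ka, el). if i < CARD('n) then entry th i else 0)"

definition chi :: "nat \<Rightarrow> 'n::finite point \<Rightarrow> real" where
  "chi i = (\<lambda>(th, ch, la, vt, ka, el). if i < CARD('n) then entry ch i else 0)"

text \<open>\<open>\<Lambda>\<close> and \<open>\<ell>\<close> are numbered \<open>1, \<dots>, n\<close>; \<open>\<Theta>, \<chi>, \<vartheta>, \<kappa>\<close> are numbered \<open>0, \<dots>, n - 1\<close>.\<close>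

definition Lam :: "nat \<Rightarrow> 'n::finite point \<Rightarrow> real" where
  "Lam j = (\<lambda>(th, ch, la, vt, ka, el). entry la (j - 1))"

definition vtheta :: "nat \<Rightarrow> 'n::finite point \<Rightarrow> real" where
  "vtheta i = (\<lambda>(th, ch, la, vt, ka, el). entry vt i)"

definition kappa :: "nat \<Rightarrow> 'n::finite point \<Rightarrow> real" where
  "kappa i = (\<lambda>(th, ch, la, vt, ka, el). entry ka i)"

definition ell :: "nat \<Rightarrow> 'n::finite point \<Rightarrow> real" where
  "ell j = (\<lambda>(th, ch, la, vt, ka, el). entry el (j - 1))"

text \<open>\<open>P_dom\<close> is (the lift of) \<open>\<XX>\<^sub>P \<times> \<T>\<^sup>n\<close>; there is no constraint on \<open>\<ell>\<close>.\<close>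

definition P_dom :: "'n::finite point set" where
  "P_dom = {p. let n = CARD('n) in
     (\<forall>i<n. 0 < chi i p) \<and> (\<forall>j\<in>{1..n}. 0 < Lam j p) \<and>
     \<bar>Theta 0 p\<bar> < chi 0 p \<and> 0 < chi (n - 1) p \<and> chi (n - 1) p < Lam n p \<and>
     (\<forall>i\<in>{1..n - 1}.
        \<bar>Theta i p\<bar> < min (chi (i - 1) p) (chi i p) \<and>
        \<not> (chi (i - 1) p - chi i p = 0 \<and> (\<exists>k::int. vtheta i p = pi + 2 * pi * of_int k)) \<and>
        sqrt ((chi (i - 1) p)\<^sup>2 + (chi i p)\<^sup>2 - 2 * (Theta i p)\<^sup>2
          + 2 * sqrt (((chi i p)\<^sup>2 - (Theta i p)\<^sup>2) * ((chi (i - 1) p)\<^sup>2 - (Theta i p)\<^sup>2))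
              * cos (vtheta i p)) < Lam i p)}"

definition R1 :: "real \<Rightarrow> real ^ 3 ^ 3" where
  "R1 \<theta> = vector [vector [1, 0, 0], vector [0, cos \<theta>, - sin \<theta>], vector [0, sin \<theta>, cos \<theta>]]"

definition R3 :: "real \<Rightarrow> real ^ 3 ^ 3" where
  "R3 \<theta> = vector [vector [cos \<theta>, - sin \<theta>, 0], vector [sin \<theta>, cos \<theta>, 0], vector [0, 0, 1]]"

definition k3 :: "real ^ 3" where
  "k3 = axis 3 1"

text \<open>
  \<open>T_mat j\<close> and \<open>S_mat j\<close> are meant for \<open>1 \<le> j \<le> n\<close>. On the domain the arguments of \<open>arccos\<close> lie in
  \<open>{-1<..<1}\<close>, so that the inclinations lie in \<open>{0<..<pi}\<close>.
\<close>

definition T_mat :: "nat \<Rightarrow> 'n::finite point \<Rightarrow> real ^ 3 ^ 3" where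
  "T_mat j p = R3 (vtheta (j - 1) p) ** R1 (arccos (Theta (j - 1) p / chi (j - 1) p))"

definition S_mat :: "nat \<Rightarrow> 'n::finite point \<Rightarrow> real ^ 3 ^ 3" where
  "S_mat j p = R3 (kappa (j - 1) p) ** R1 (arccos (Theta j p / chi (j - 1) p))"

text \<open>\<open>TS_prod j = T\<^sub>1 S\<^sub>1 \<cdots> T\<^sub>j S\<^sub>j\<close>\<close>

primrec TS_prod :: "nat \<Rightarrow> 'n::finite point \<Rightarrow> real ^ 3 ^ 3" where
  "TS_prod 0 p = mat 1"
| "TS_prod (Suc j) p = TS_prod j p ** T_mat (Suc j) p ** S_mat (Suc j) p"

definition C_vec :: "nat \<Rightarrow> 'n::finite point \<Rightarrow> real ^ 3" where
  "C_vec j p = (TS_prod (j - 1) p ** T_mat j p) *v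
     (chi (j - 1) p *\<^sub>R k3
      - (if j = CARD('n) then 0 else chi j p *\<^sub>R ((S_mat j p ** T_mat (j + 1) p) *v k3)))"

definition N_vec :: "nat \<Rightarrow> 'n::finite point \<Rightarrow> real ^ 3" where
  "N_vec j p = C_vec j p /\<^sub>R norm (C_vec j p)"

definition Peri :: "nat \<Rightarrow> 'n::finite point \<Rightarrow> real ^ 3" where
  "Peri j p = TS_prod j p *v k3"

definition Q_vec :: "nat \<Rightarrow> 'n::finite point \<Rightarrow> real ^ 3" where
  "Q_vec j p = cross3 (N_vec j p) (Peri j p)"

definition semi_axis :: "(nat \<Rightarrow> real) \<Rightarrow> (nat \<Rightarrow> real) \<Rightarrow> nat \<Rightarrow> 'n::finite point \<Rightarrow> real" where
  "semi_axis m M j p = 1 / M j * (Lam j p / m j)\<^sup>2"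

definition ecc :: "nat \<Rightarrow> 'n::finite point \<Rightarrow> real" where
  "ecc j p = sqrt (1 - (norm (C_vec j p))\<^sup>2 / (Lam j p)\<^sup>2)"

definition zeta :: "nat \<Rightarrow> 'n::finite point \<Rightarrow> real" where
  "zeta j p = (THE z. z - ecc j p * sin z = ell j p)"

definition x_P :: "(nat \<Rightarrow> real) \<Rightarrow> (nat \<Rightarrow> real) \<Rightarrow> nat \<Rightarrow> 'n::finite point \<Rightarrow> real ^ 3" where
  "x_P m M j p =
     (let a = semi_axis m M j p; e = ecc j p; z = zeta j p in
      (a * (cos z - e)) *\<^sub>R Peri j p + (a * sqrt (1 - e\<^sup>2) * sin z) *\<^sub>R Q_vec j p)"

definition y_P :: "(nat \<Rightarrow> real) \<Rightarrow> (nat \<Rightarrow> real) \<Rightarrow> nat \<Rightarrow> 'n::finite point \<Rightarrow> real ^ 3" where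
  "y_P m M j p =
     (let a = semi_axis m M j p; e = ecc j p; z = zeta j p in
      (- m j * sqrt (M j / a) * (sin z / (1 - e * cos z))) *\<^sub>R Peri j p
      + (m j * sqrt (M j * (1 - e\<^sup>2) / a) * (cos z / (1 - e * cos z))) *\<^sub>R Q_vec j p)"

text \<open>
  \<open>to_nat_on UNIV\<close> inverts the numbering of the coordinates, so body \<open>j \<in> {1..n}\<close> sits at the index
  with number \<open>j - 1\<close>; see \<open>entry_P_map\<close>.
\<close>

definition P_map :: "(nat \<Rightarrow> real) \<Rightarrow> (nat \<Rightarrow> real) \<Rightarrow> 'n::finite point \<Rightarrow>
    (real ^ 3 ^ 'n) \<times> (real ^ 3 ^ 'n)" where
  "P_map m M p =
     (\<chi> k. y_P m M (Suc (to_nat_on UNIV k)) p, \<chi> k. x_P m M (Suc (to_nat_on UNIV k)) p)"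

definition d_form :: "('a::real_normed_vector \<Rightarrow> real) \<Rightarrow> 'a \<Rightarrow> 'a \<Rightarrow> real" where
  "d_form f p = frechet_derivative f (at p)"

definition wedge :: "('a \<Rightarrow> 'a \<Rightarrow> real) \<Rightarrow> ('a \<Rightarrow> 'a \<Rightarrow> real) \<Rightarrow> 'a \<Rightarrow> 'a \<Rightarrow> 'a \<Rightarrow> real" where
  "wedge \<alpha> \<beta> p u v = \<alpha> p u * \<beta> p v - \<alpha> p v * \<beta> p u"

definition wedge3 :: "('a::real_normed_vector \<Rightarrow> real ^ 3) \<Rightarrow> ('a \<Rightarrow> real ^ 3) \<Rightarrow>
    'a \<Rightarrow> 'a \<Rightarrow> 'a \<Rightarrow> real" where
  "wedge3 y x p u v =
     (\<Sum>k\<in>UNIV. wedge (d_form (\<lambda>q. y q $ k)) (d_form (\<lambda>q. x q $ k)) p u v)"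

lemma entry_P_map:
  fixes p :: "'n::finite point"
  assumes "j \<in> {1..CARD('n)}"
  shows "entry (fst (P_map m M p)) (j - 1) = y_P m M j p"
    and "entry (snd (P_map m M p)) (j - 1) = x_P m M j p"
proof -
  have "to_nat_on UNIV (from_nat_into UNIV (j - 1) :: 'n) = j - 1"
    using assms bij_betw_from_nat_into_finite[of "UNIV :: 'n set"]
      to_nat_on_finite[of "UNIV :: 'n set"]
    by (auto simp: from_nat_into_def bij_betw_def inv_into_into f_inv_into_f)
  then show "entry (fst (P_map m M p)) (j - 1) = y_P m M j p"
    and "entry (snd (P_map m M p)) (j - 1) = x_P m M j p"
    using assms by (auto simp: entry_def P_map_def)
qed

lemma kepler_unique:
  fixes e l :: real
  assumes "\<bar>e\<bar> < 1"
  shows "\<exists>!z. z - e * sin z = l"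
proof -
  let ?f = "\<lambda>z. z - e * sin z"
  have bound: "\<bar>e * sin z\<bar> \<le> 1" for z
    using assms abs_sin_le_one[of z] by (simp add: abs_mult mult_le_one)
  have der: "(?f has_real_derivative 1 - e * cos z) (at z)" for z
    by (auto intro!: derivative_eq_intros)
  have pos: "0 < 1 - e * cos z" for z
  proof -
    have "\<bar>e * cos z\<bar> \<le> \<bar>e\<bar>"
      using abs_cos_le_one[of z] by (simp add: abs_mult mult_left_le)
    then show ?thesis using assms by linarith
  qed
  have mono: "?f x < ?f y" if "x < y" for x y
    by (rule DERIV_pos_imp_increasing[OF that]) (use der pos in blast)
  have "\<exists>z. l - 1 \<le> z \<and> z \<le> l + 1 \<and> ?f z = l"
  proof (rule IVT')
    show "?f (l - 1) \<le> l" using bound[of "l - 1"] by linarith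
    show "l \<le> ?f (l + 1)" using bound[of "l + 1"] by linarith
  qed (auto intro!: continuous_on_diff continuous_on_mult continuous_on_sin)
  moreover have "x = y" if "?f x = l" "?f y = l" for x y
    using mono[of x y] mono[of y x] that by (cases x y rule: linorder_cases) auto
  ultimately show ?thesis by blast
qed

lemma R1_orthogonal: "orthogonal_matrix (R1 t)"
  by (simp add: orthogonal_matrix_def R1_def matrix_matrix_mult_def transpose_def mat_def
      vec_eq_iff forall_3 sum_3 vector_3 flip: power2_eq_square)

lemma R3_orthogonal: "orthogonal_matrix (R3 t)"
  by (simp add: orthogonal_matrix_def R3_def matrix_matrix_mult_def transpose_def mat_def
      vec_eq_iff forall_3 sum_3 vector_3 flip: power2_eq_square)

lemma norm_orthogonal_matrix:
  fixes A :: "real ^ 3 ^ 3"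
  assumes "orthogonal_matrix A"
  shows "norm (A *v w) = norm w"
proof -
  have "orthogonal_transformation ((*v) A)"
    using assms by (simp add: orthogonal_transformation_matrix matrix_of_matrix_vector_mul)
  then show ?thesis by (rule orthogonal_transformation_norm)
qed

lemma T_mat_orthogonal: "orthogonal_matrix (T_mat j p)"
  by (simp add: T_mat_def orthogonal_matrix_mul R1_orthogonal R3_orthogonal)

lemma S_mat_orthogonal: "orthogonal_matrix (S_mat j p)"
  by (simp add: S_mat_def orthogonal_matrix_mul R1_orthogonal R3_orthogonal)

lemma TS_prod_orthogonal: "orthogonal_matrix (TS_prod j p)"
  by (induction j)
    (simp_all add: orthogonal_matrix_id orthogonal_matrix_mul T_mat_orthogonal S_mat_orthogonal)

lemma norm_k3: "norm k3 = 1"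
  by (simp add: k3_def norm_axis_1)

lemma k3_ST_k3:
  "k3 \<bullet> ((R3 ka ** R1 b ** (R3 vt ** R1 c)) *v k3) = cos b * cos c - sin b * sin c * cos vt"
  by (simp add: k3_def inner_vec_def R1_def R3_def matrix_matrix_mult_def
      matrix_vector_mult_def sum_3 vector_3 axis_def)

lemma norm_C_vec_last:
  fixes p :: "'n::finite point"
  assumes "0 < chi (CARD('n) - 1) p"
  shows "norm (C_vec (CARD('n)) p) = chi (CARD('n) - 1) p"
  using assms
  by (simp add: C_vec_def norm_orthogonal_matrix orthogonal_matrix_mul TS_prod_orthogonal
      T_mat_orthogonal norm_k3)

lemma norm_C_vec:
  fixes p :: "'n::finite point"
  assumes j: "j \<in> {1..CARD('n) - 1}"
    and th: "\<bar>Theta j p\<bar> < min (chi (j - 1) p) (chi j p)"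
  shows "(norm (C_vec j p))\<^sup>2 = (chi (j - 1) p)\<^sup>2 + (chi j p)\<^sup>2 - 2 * (Theta j p)\<^sup>2
    + 2 * sqrt (((chi j p)\<^sup>2 - (Theta j p)\<^sup>2) * ((chi (j - 1) p)\<^sup>2 - (Theta j p)\<^sup>2))
        * cos (vtheta j p)"
proof -
  define t x y where "t = Theta j p" and "x = chi (j - 1) p" and "y = chi j p"
  have pos: "0 < x" "0 < y" "\<bar>t\<bar> < x" "\<bar>t\<bar> < y"
    using th by (auto simp: t_def x_def y_def)
  have sin: "sin (arccos (t / z)) = sqrt (z\<^sup>2 - t\<^sup>2) / z"
    and cos: "cos (arccos (t / z)) = t / z" if "0 < z" "\<bar>t\<bar> < z" for z
  proof -
    have b: "- 1 \<le> t / z" "t / z \<le> 1"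
      using that by (auto simp: field_simps)
    then show "cos (arccos (t / z)) = t / z" by simp
    have "sin (arccos (t / z)) = sqrt (1 - (t / z)\<^sup>2)" using b by (simp add: sin_arccos)
    also have "1 - (t / z)\<^sup>2 = (z\<^sup>2 - t\<^sup>2) / z\<^sup>2" using that by (simp add: field_simps)
    also have "sqrt \<dots> = sqrt (z\<^sup>2 - t\<^sup>2) / z" using that by (simp add: real_sqrt_divide)
    finally show "sin (arccos (t / z)) = sqrt (z\<^sup>2 - t\<^sup>2) / z" .
  qed
  define w where "w = (S_mat j p ** T_mat (j + 1) p) *v k3"
  have w1: "norm w = 1"
    by (simp add: w_def norm_orthogonal_matrix orthogonal_matrix_mul S_mat_orthogonal
        T_mat_orthogonal norm_k3)
  have "k3 \<bullet> w = t / x * (t / y) - sqrt (x\<^sup>2 - t\<^sup>2) / x * (sqrt (y\<^sup>2 - t\<^sup>2) / y) * cos (vtheta j p)"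
    unfolding w_def S_mat_def T_mat_def
      add_diff_cancel_right' k3_ST_k3 t_def[symmetric] x_def[symmetric] y_def[symmetric]
    by (simp only: sin cos pos)
  then have kw: "x * y * (k3 \<bullet> w) = t\<^sup>2 - sqrt ((y\<^sup>2 - t\<^sup>2) * (x\<^sup>2 - t\<^sup>2)) * cos (vtheta j p)"
    using pos unfolding real_sqrt_mult by (simp add: field_simps power2_eq_square)
  have "norm (C_vec j p) = norm (x *\<^sub>R k3 - y *\<^sub>R w)"
    using j unfolding C_vec_def
    by (simp add: norm_orthogonal_matrix orthogonal_matrix_mul TS_prod_orthogonal
        T_mat_orthogonal x_def y_def w_def) linarith
  then have "(norm (C_vec j p))\<^sup>2 = (x *\<^sub>R k3 - y *\<^sub>R w) \<bullet> (x *\<^sub>R k3 - y *\<^sub>R w)"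
    by (simp add: power2_norm_eq_inner)
  also have "\<dots> = x\<^sup>2 * (norm k3)\<^sup>2 + y\<^sup>2 * (norm w)\<^sup>2 - 2 * (x * y * (k3 \<bullet> w))"
    unfolding power2_norm_eq_inner
    by (simp add: inner_diff_left inner_diff_right inner_commute power2_eq_square algebra_simps)
  finally show ?thesis
    unfolding w1 norm_k3 kw t_def[symmetric] x_def[symmetric] y_def[symmetric] by simp
qed

lemma C_vec_bounds:
  fixes p :: "'n::finite point"
  assumes p: "p \<in> P_dom" and j: "j \<in> {1..CARD('n)}"
  shows "C_vec j p \<noteq> 0" and "norm (C_vec j p) < Lam j p"
proof -
  have "C_vec j p \<noteq> 0 \<and> norm (C_vec j p) < Lam j p"
  proof (cases "j = CARD('n)")
    case True
    have "0 < chi (CARD('n) - 1) p" "chi (CARD('n) - 1) p < Lam (CARD('n)) p"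
      using p by (auto simp: P_dom_def Let_def)
    then show ?thesis using norm_C_vec_last[of p] True by auto
  next
    case False
    then have j': "j \<in> {1..CARD('n) - 1}" using j by auto
    define t x y c where "t = Theta j p" and "x = chi (j - 1) p" and "y = chi j p"
      and "c = cos (vtheta j p)"
    have th: "\<bar>Theta j p\<bar> < min (chi (j - 1) p) (chi j p)"
      and ne: "\<not> (chi (j - 1) p - chi j p = 0 \<and> (\<exists>k::int. vtheta j p = pi + 2 * pi * of_int k))"
      and lt: "sqrt (x\<^sup>2 + y\<^sup>2 - 2 * t\<^sup>2 + 2 * sqrt ((y\<^sup>2 - t\<^sup>2) * (x\<^sup>2 - t\<^sup>2)) * c) < Lam j p"
      using p j' by (auto simp: P_dom_def Let_def t_def x_def y_def c_def)
    have n2: "(norm (C_vec j p))\<^sup>2 = x\<^sup>2 + y\<^sup>2 - 2 * t\<^sup>2 + 2 * sqrt ((y\<^sup>2 - t\<^sup>2) * (x\<^sup>2 - t\<^sup>2)) * c"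
      using norm_C_vec[OF j' th] by (simp add: t_def x_def y_def c_def)
    have "norm (C_vec j p) < Lam j p"
      using lt unfolding n2[symmetric] by simp
    moreover have "C_vec j p \<noteq> 0"
    proof
      assume "C_vec j p = 0"
      define r s where "r = sqrt (x\<^sup>2 - t\<^sup>2)" and "s = sqrt (y\<^sup>2 - t\<^sup>2)"
      have ab: "0 < x" "0 < y" "\<bar>t\<bar> < x" "\<bar>t\<bar> < y"
        using th by (auto simp: t_def x_def y_def)
      have sq: "t\<^sup>2 < x\<^sup>2" "t\<^sup>2 < y\<^sup>2"
        using power_strict_mono[OF ab(3), of 2] power_strict_mono[OF ab(4), of 2] by simp_all
      have rs: "0 < r" "0 < s" "r\<^sup>2 = x\<^sup>2 - t\<^sup>2" "s\<^sup>2 = y\<^sup>2 - t\<^sup>2"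
        using sq by (simp_all add: r_def s_def)
      have "0 = r\<^sup>2 + s\<^sup>2 + 2 * (s * r) * c"
        using n2 \<open>C_vec j p = 0\<close>
        unfolding rs(3,4) real_sqrt_mult r_def[symmetric] s_def[symmetric] by simp
      also have "\<dots> = (r - s)\<^sup>2 + 2 * (s * r) * (1 + c)"
        by (simp add: power2_eq_square algebra_simps)
      finally have z: "(r - s)\<^sup>2 + 2 * (s * r) * (1 + c) = 0" by simp
      have c1: "0 \<le> 1 + c" using cos_ge_minus_one[of "vtheta j p"] unfolding c_def by linarith
      have "0 \<le> 2 * (s * r) * (1 + c)" using rs c1 by simp
      with z have "(r - s)\<^sup>2 = 0" "2 * (s * r) * (1 + c) = 0"
        using zero_le_power2[of "r - s"] by linarith+
      then have "r = s" "c = - 1" using rs by auto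
      have "x\<^sup>2 = y\<^sup>2" using rs \<open>r = s\<close> by simp
      then have "x = y" using ab by (simp add: power2_eq_iff)
      moreover have "\<exists>k::int. vtheta j p = pi + 2 * pi * of_int k"
      proof -
        have "cos (vtheta j p - pi) = 1" using \<open>c = - 1\<close> by (simp add: c_def cos_diff)
        then obtain k :: int where "vtheta j p - pi = of_int k * 2 * pi"
          using cos_one_2pi_int by blast
        then show ?thesis by (intro exI[of _ k]) (simp add: algebra_simps)
      qed
      ultimately show False using ne by (simp add: x_def y_def)
    qed
    ultimately show ?thesis by blast
  qed
  then show "C_vec j p \<noteq> 0" and "norm (C_vec j p) < Lam j p" by auto
qed

lemma ecc_bounds:
  fixes p :: "'n::finite point"
  assumes p: "p \<in> P_dom" and j: "j \<in> {1..CARD('n)}"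
  shows "0 < ecc j p" and "ecc j p < 1"
proof -
  have c: "0 < norm (C_vec j p)" "norm (C_vec j p) < Lam j p"
    using C_vec_bounds[OF p j] by auto
  then have "0 < Lam j p" by linarith
  have "(norm (C_vec j p))\<^sup>2 < (Lam j p)\<^sup>2"
    using c by (intro power_strict_mono) auto
  then have "(norm (C_vec j p))\<^sup>2 / (Lam j p)\<^sup>2 < 1" "0 < (norm (C_vec j p))\<^sup>2 / (Lam j p)\<^sup>2"
    using c \<open>0 < Lam j p\<close> by simp_all
  then show "0 < ecc j p" and "ecc j p < 1"
    unfolding ecc_def real_sqrt_gt_0_iff real_sqrt_lt_1_iff by linarith+
qed

text \<open>\<open>same_point p q\<close>: \<open>p\<close> and \<open>q\<close> are lifts of the same point.\<close>

definition same_point :: "'n::finite point \<Rightarrow> 'n point \<Rightarrow> bool" where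
  "same_point p q \<longleftrightarrow>
     (\<forall>i. Theta i p = Theta i q \<and> chi i p = chi i q \<and> Lam i p = Lam i q) \<and>
     (\<forall>i. (\<exists>k::int. vtheta i q = vtheta i p + 2 * pi * of_int k) \<and>
          (\<exists>k::int. kappa i q = kappa i p + 2 * pi * of_int k) \<and>
          (\<exists>k::int. ell i q = ell i p + 2 * pi * of_int k))"

lemma shift_2pi:
  fixes a :: real and k :: int
  shows "sin (a + 2 * pi * of_int k) = sin a" and "cos (a + 2 * pi * of_int k) = cos a"
  using sin_int_2pin[of k] cos_int_2pin[of k] by (simp_all add: sin_add cos_add)

lemma P_dom_torus:
  fixes p q :: "'n::finite point"
  assumes pq: "same_point p q" and p: "p \<in> P_dom"
  shows "q \<in> P_dom"
proof -
  have eq: "Theta i q = Theta i p" "chi i q = chi i p" "Lam i q = Lam i p" for i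
    using pq by (simp_all add: same_point_def)
  have vt: "\<exists>k::int. vtheta i q = vtheta i p + 2 * pi * of_int k" for i
    using pq by (simp add: same_point_def)
  have c: "cos (vtheta i q) = cos (vtheta i p)" for i
    using vt[of i] by (auto simp: shift_2pi)
  have ex: "(\<exists>k::int. vtheta i q = pi + 2 * pi * of_int k) \<longleftrightarrow>
        (\<exists>k::int. vtheta i p = pi + 2 * pi * of_int k)" for i
  proof -
    obtain k0 :: int where k0: "vtheta i q = vtheta i p + 2 * pi * of_int k0"
      using vt by blast
    show ?thesis
    proof
      assume "\<exists>k::int. vtheta i q = pi + 2 * pi * of_int k"
      then obtain k :: int where "vtheta i q = pi + 2 * pi * of_int k" ..
      then show "\<exists>k::int. vtheta i p = pi + 2 * pi * of_int k"
        using k0 by (intro exI[of _ "k - k0"]) (simp add: algebra_simps)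
    next
      assume "\<exists>k::int. vtheta i p = pi + 2 * pi * of_int k"
      then obtain k :: int where "vtheta i p = pi + 2 * pi * of_int k" ..
      then show "\<exists>k::int. vtheta i q = pi + 2 * pi * of_int k"
        using k0 by (intro exI[of _ "k + k0"]) (simp add: algebra_simps)
    qed
  qed
  show ?thesis using p unfolding P_dom_def Let_def mem_Collect_eq eq c ex .
qed

lemma P_map_torus:
  fixes p q :: "'n::finite point"
  assumes pq: "same_point p q" and p: "p \<in> P_dom"
  shows "P_map m M q = P_map m M p"
proof -
  have eq: "Theta i q = Theta i p" "chi i q = chi i p" "Lam i q = Lam i p" for i
    using pq by (simp_all add: same_point_def)
  have "sin (vtheta i q) = sin (vtheta i p)" "cos (vtheta i q) = cos (vtheta i p)"
    "sin (kappa i q) = sin (kappa i p)" "cos (kappa i q) = cos (kappa i p)" for i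
    using pq unfolding same_point_def by (metis shift_2pi)+
  then have T: "T_mat i q = T_mat i p" and S: "S_mat i q = S_mat i p" for i
    by (simp_all add: T_mat_def S_mat_def R3_def eq)
  have TS: "TS_prod i q = TS_prod i p" for i
    by (induction i) (simp_all add: T S)
  have C: "C_vec i q = C_vec i p" for i
    by (simp add: C_vec_def T S TS eq)
  have E: "ecc i q = ecc i p" for i
    by (simp add: ecc_def C eq)
  have z: "\<exists>k::int. zeta j q = zeta j p + 2 * pi * of_int k" if j: "j \<in> {1..CARD('n)}" for j
  proof -
    obtain k :: int where k: "ell j q = ell j p + 2 * pi * of_int k"
      using pq by (auto simp: same_point_def)
    have "\<bar>ecc j p\<bar> < 1" using ecc_bounds[OF p j] by simp
    note ex1 = kepler_unique[OF this]
    have "zeta j p - ecc j p * sin (zeta j p) = ell j p"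
      unfolding zeta_def by (rule theI') (rule ex1)
    then have "(zeta j p + 2 * pi * of_int k) - ecc j p * sin (zeta j p + 2 * pi * of_int k)
        = ell j q"
      by (simp add: shift_2pi k)
    then have "zeta j q = zeta j p + 2 * pi * of_int k"
      unfolding zeta_def[of j q] E by (intro the1_equality ex1)
    then show ?thesis ..
  qed
  have sc: "sin (zeta j q) = sin (zeta j p)" "cos (zeta j q) = cos (zeta j p)"
    if "j \<in> {1..CARD('n)}" for j
    using z[OF that] by (auto simp: shift_2pi)
  then have xy: "x_P m M j q = x_P m M j p" "y_P m M j q = y_P m M j p"
    if "j \<in> {1..CARD('n)}" for j
    by (simp_all only: x_P_def y_P_def semi_axis_def Q_vec_def N_vec_def Peri_def E C TS eq
        Let_def sc[OF that])
  have "Suc (to_nat_on UNIV (i :: 'n)) \<in> {1..CARD('n)}" for i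
    using bij_betwE[OF to_nat_on_finite[of "UNIV :: 'n set"]] by (simp add: Suc_le_eq)
  then show ?thesis by (simp add: P_map_def xy)
qed

end

theory Submission
  imports Defs
begin

text \<open>
  If \<open>\<omega>\<^sub>j\<close> is the angular velocity of the orbital frame \<open>(P\<^sub>j, Q\<^sub>j, N\<^sub>j)\<close>, then \<open>dy \<and> dx\<close> for body \<open>j\<close> is its
  value for a fixed frame, which is the planar Kepler form \<open>d\<Lambda>\<^sub>j \<and> d\<ell>\<^sub>j\<close>, plus the exterior derivative of
  \<open>C\<^sub>j \<bullet> \<omega>\<^sub>j\<close>. Since \<open>C\<^sub>j\<close> is orthogonal to \<open>P\<^sub>j\<close>, rotating the frame about the perihelion direction
  does not change this form, and \<open>\<omega>\<^sub>j\<close> may be replaced by the angular velocity \<open>\<Omega>\<^sub>j\<close> of \<open>T\<^sub>1 S\<^sub>1 \<cdots> T\<^sub>j S\<^sub>j\<close>.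
  Now \<open>C\<^sub>j = W\<^bsub>j-1\<^esub> - W\<^sub>j\<close> with \<open>W\<^sub>j = \<chi>\<^sub>j T\<^sub>1 S\<^sub>1 \<cdots> T\<^sub>j S\<^sub>j T\<^bsub>j+1\<^esub> k\<^sub>3\<close> and \<open>W\<^sub>n = 0\<close>, so the sum over \<open>j\<close>
  rearranges into the sum of the derivatives of \<open>W\<^bsub>j-1\<^esub> \<bullet> (\<Omega>\<^sub>j - \<Omega>\<^bsub>j-1\<^esub>)\<close>. Of the four elementary rotations
  that lead from \<open>\<Omega>\<^bsub>j-1\<^esub>\<close> to \<open>\<Omega>\<^sub>j\<close> the two about node lines have axes orthogonal to \<open>W\<^bsub>j-1\<^esub>\<close>, and the
  other two contribute \<open>\<Theta>\<^bsub>j-1\<^esub> d\<vartheta>\<^bsub>j-1\<^esub>\<close> and \<open>\<chi>\<^bsub>j-1\<^esub> d\<kappa>\<^bsub>j-1\<^esub>\<close>.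
\<close>

section \<open>Angular velocities\<close>

lemma bounded_bilinear_cross3: "bounded_bilinear cross3"
  using bilinear_cross by (simp add: bilinear_conv_bounded_bilinear)

lemma matrix_vector_mult_eq_sum_axis:
  fixes A :: "real ^ 3 ^ 3"
  shows "A *v x = (\<Sum>i\<in>UNIV. (x $ i) *\<^sub>R (A *v axis i 1))"
  by (simp add: vec_eq_iff matrix_vector_mult_def axis_def if_distrib[of "(*) _"] mult.commute
      cong: if_cong)

lemma has_derivative_transform_nhds:
  assumes f: "(f has_derivative f') (at p)" and fg: "\<forall>\<^sub>F q in nhds p. f q = g q"
  shows "(g has_derivative f') (at p)"
proof (rule has_derivative_transform_eventually[OF f])
  show "\<forall>\<^sub>F q in at p. f q = g q"
    using fg by (simp add: eventually_at_filter eventually_mono)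
  show "f p = g p"
    using eventually_nhds_x_imp_x[OF fg] .
qed simp

text \<open>The matrix is differentiated on fixed vectors, which avoids derivatives in a space of
  matrices; \<open>\<omega>\<close> is the angular velocity one-form in the fixed frame. Proper
  rotations are required because they commute with \<open>cross3\<close>.\<close>

definition spins ::
  "('a::real_normed_vector \<Rightarrow> real ^ 3 ^ 3) \<Rightarrow> ('a \<Rightarrow> real ^ 3) \<Rightarrow> 'a \<Rightarrow> bool" where
  "spins A \<omega> p \<longleftrightarrow> rotation_matrix (A p) \<and>
     (\<forall>w. ((\<lambda>q. A q *v w) has_derivative (\<lambda>u. cross3 (\<omega> u) (A p *v w))) (at p))"

definition one_parameter_rotation :: "(real \<Rightarrow> real ^ 3 ^ 3) \<Rightarrow> real ^ 3 \<Rightarrow> bool" where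
  "one_parameter_rotation R k \<longleftrightarrow>
     (\<forall>t. rotation_matrix (R t) \<and> R t *v k = k \<and>
       (\<forall>w. ((\<lambda>s. R s *v w) has_vector_derivative cross3 k (R t *v w)) (at t)))"

lemma has_derivative_vec_componentwise:
  fixes f :: "'a::real_normed_vector \<Rightarrow> 'b::euclidean_space ^ 'n::finite"
  assumes "\<And>i. ((\<lambda>x. f x $ i) has_derivative (\<lambda>u. f' u $ i)) (at p)"
  shows "(f has_derivative f') (at p)"
  using assms
  by (subst has_derivative_componentwise_within)
    (auto simp: Basis_vec_def inner_axis intro!: has_derivative_inner_left)

lemma R1_one_parameter_rotation: "one_parameter_rotation R1 (axis 1 1)"
  unfolding one_parameter_rotation_def
proof (intro allI conjI)
  fix t and w :: "real ^ 3"
  show "rotation_matrix (R1 t)"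
    unfolding rotation_matrix_def
    using R1_orthogonal[of t] by (simp add: R1_def det_3 vector_3 flip: power2_eq_square)
  show "R1 t *v axis 1 1 = axis 1 1"
    by (simp add: R1_def vec_eq_iff forall_3 matrix_vector_mult_def sum_3 vector_3 axis_def)
  have "((\<lambda>s. (R1 s *v w) $ i) has_derivative (\<lambda>h. h * cross3 (axis 1 1) (R1 t *v w) $ i)) (at t)"
    for i :: 3
    using exhaust_3[of i]
    by (auto simp: R1_def matrix_vector_mult_def sum_3 vector_3 axis_def cross3_def
        algebra_simps intro!: derivative_eq_intros)
  then show "((\<lambda>s. R1 s *v w) has_vector_derivative cross3 (axis 1 1) (R1 t *v w)) (at t)"
    unfolding has_vector_derivative_def by (intro has_derivative_vec_componentwise) simp
qed

lemma R3_one_parameter_rotation: "one_parameter_rotation R3 k3"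
  unfolding one_parameter_rotation_def
proof (intro allI conjI)
  fix t and w :: "real ^ 3"
  show "rotation_matrix (R3 t)"
    unfolding rotation_matrix_def
    using R3_orthogonal[of t] by (simp add: R3_def det_3 vector_3 flip: power2_eq_square)
  show "R3 t *v k3 = k3"
    by (simp add: R3_def k3_def vec_eq_iff forall_3 matrix_vector_mult_def sum_3 vector_3 axis_def)
  have "((\<lambda>s. (R3 s *v w) $ i) has_derivative (\<lambda>h. h * cross3 k3 (R3 t *v w) $ i)) (at t)"
    for i :: 3
    using exhaust_3[of i]
    by (auto simp: R3_def k3_def matrix_vector_mult_def sum_3 vector_3 axis_def cross3_def
        algebra_simps intro!: derivative_eq_intros)
  then show "((\<lambda>s. R3 s *v w) has_vector_derivative cross3 k3 (R3 t *v w)) (at t)"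
    unfolding has_vector_derivative_def by (intro has_derivative_vec_componentwise) simp
qed

text \<open>The derivative of \<open>A\<close> is known on fixed vectors only, so \<open>z\<close>
  is expanded in the standard basis and the product rule is applied term by term.\<close>

lemma spins_has_derivative:
  assumes A: "spins A \<omega> p" and z: "(z has_derivative z') (at p)"
  shows "((\<lambda>q. A q *v z q) has_derivative
    (\<lambda>u. A p *v z' u + cross3 (\<omega> u) (A p *v z p))) (at p)"
proof -
  let ?e = "\<lambda>i. axis i 1 :: real ^ 3"
  have "((\<lambda>q. z q $ i) has_derivative (\<lambda>u. z' u $ i)) (at p)" for i
    using bounded_linear.has_derivative[OF bounded_linear_vec_nth z] .
  then have "((\<lambda>q. \<Sum>i\<in>UNIV. (z q $ i) *\<^sub>R (A q *v ?e i)) has_derivative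
      (\<lambda>u. \<Sum>i\<in>UNIV. (z p $ i) *\<^sub>R cross3 (\<omega> u) (A p *v ?e i)
        + (z' u $ i) *\<^sub>R (A p *v ?e i))) (at p)"
    using A unfolding spins_def by (intro has_derivative_sum has_derivative_scaleR) auto
  moreover have "(\<Sum>i\<in>UNIV. (z p $ i) *\<^sub>R cross3 (\<omega> u) (A p *v ?e i)
        + (z' u $ i) *\<^sub>R (A p *v ?e i)) = A p *v z' u + cross3 (\<omega> u) (A p *v z p)" for u
    unfolding matrix_vector_mult_eq_sum_axis[of _ "z' u"] matrix_vector_mult_eq_sum_axis[of _ "z p"]
    by (simp add: sum_3 cross_add_right cross_mult_right algebra_simps)
  ultimately show ?thesis
    by (simp flip: matrix_vector_mult_eq_sum_axis)
qed

text \<open>Angular velocities add. The inner factor turns about \<open>k\<close>, and a rotation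
  carries cross products to cross products, so the fixed frame sees this axis as
  \<open>A p *v k\<close>.\<close>

lemma spins_mult_axis:
  assumes A: "spins A \<omega> p" and R: "one_parameter_rotation R k"
    and \<phi>: "(\<phi> has_derivative \<phi>') (at p)"
  shows "spins (\<lambda>q. A q ** R (\<phi> q)) (\<lambda>u. \<omega> u + \<phi>' u *\<^sub>R (A p *v k)) p"
  unfolding spins_def
proof (intro conjI allI)
  have rot: "rotation_matrix (A p)" "rotation_matrix (R t)" for t
    using A R by (auto simp: spins_def one_parameter_rotation_def)
  then show "rotation_matrix (A p ** R (\<phi> p))"
    by (simp add: rotation_matrix_def orthogonal_matrix_mul det_mul)
  fix w
  have "((\<lambda>s. R s *v w) has_vector_derivative cross3 k (R (\<phi> p) *v w)) (at (\<phi> p))"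
    using R by (auto simp: one_parameter_rotation_def)
  then have "((\<lambda>q. R (\<phi> q) *v w) has_derivative
      (\<lambda>u. \<phi>' u *\<^sub>R cross3 k (R (\<phi> p) *v w))) (at p)"
    unfolding has_vector_derivative_def by (rule has_derivative_compose[OF \<phi>])
  from spins_has_derivative[OF A this]
  show "((\<lambda>q. A q ** R (\<phi> q) *v w) has_derivative
      (\<lambda>u. cross3 (\<omega> u + \<phi>' u *\<^sub>R (A p *v k)) (A p ** R (\<phi> p) *v w))) (at p)"
    by (simp add: matrix_vector_mult_scaleR cross_rotation_matrix[OF rot(1), symmetric]
        cross_add_left cross_mult_left add.commute flip: matrix_vector_mul_assoc)
qed

text \<open>
  The arguments \<open>c\<close> and \<open>c'\<close> are the value and the derivative at a point of a vector function; the result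
  is the exterior derivative of its inner product with the one-form \<open>\<omega>\<close>, in which \<open>d\<omega>\<close> has been eliminated by the structure
  equation \<open>d\<omega>(u, v) = \<omega>(u) \<times> \<omega>(v)\<close> of angular velocities.
\<close>

definition spin_form :: "('a \<Rightarrow> real ^ 3) \<Rightarrow> real ^ 3 \<Rightarrow> ('a \<Rightarrow> real ^ 3) \<Rightarrow> 'a \<Rightarrow> 'a \<Rightarrow> real" where
  "spin_form \<omega> c c' u v = c' u \<bullet> \<omega> v - c' v \<bullet> \<omega> u + cross3 (\<omega> u) (\<omega> v) \<bullet> c"

lemma spin_form_diff:
  "spin_form \<omega> (c - d) (\<lambda>u. c' u - d' u) u v = spin_form \<omega> c c' u v - spin_form \<omega> d d' u v"
  by (simp add: spin_form_def inner_diff_left inner_diff_right)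

text \<open>The axis \<open>w\<close> is itself carried by \<open>\<omega>\<close>, so the quadratic
  term of \<open>spin_form\<close> completes \<open>w p \<bullet> C' u\<close> to the differential
  \<open>h\<close> of \<open>w \<bullet> C\<close>. In particular, turning about an axis that stays
  orthogonal to \<open>C\<close> changes nothing.\<close>

lemma spin_form_add_axis:
  assumes w: "(w has_derivative (\<lambda>u. cross3 (\<omega> u) (w p))) (at p)"
    and C: "(C has_derivative C') (at p)"
    and h: "((\<lambda>q. w q \<bullet> C q) has_derivative h) (at p)"
  shows "spin_form (\<lambda>u. \<omega> u + \<phi> u *\<^sub>R w p) (C p) C' u v =
    spin_form \<omega> (C p) C' u v + (h u * \<phi> v - h v * \<phi> u)"
proof -
  have "((\<lambda>q. w q \<bullet> C q) has_derivative (\<lambda>u. w p \<bullet> C' u + cross3 (\<omega> u) (w p) \<bullet> C p)) (at p)"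
    by (rule has_derivative_inner[OF w C])
  then have h: "h = (\<lambda>u. w p \<bullet> C' u + cross3 (\<omega> u) (w p) \<bullet> C p)"
    using h has_derivative_unique by blast
  show ?thesis
    unfolding spin_form_def h by (simp add: cross3_simps)
qed

text \<open>In a turning frame, \<open>x'\<close> and \<open>y'\<close> are their fixed-frame values
  plus cross products with \<open>\<omega>\<close>. Because \<open>y \<bullet> cross3 (\<omega> u) x
  = \<omega> u \<bullet> cross3 x y\<close>, the extra terms form the exterior derivative of
  \<open>C \<bullet> \<omega>\<close> with \<open>C = cross3 x y\<close>.\<close>

lemma wedge_spinning_frame:
  fixes P Q :: "'a::real_normed_vector \<Rightarrow> real ^ 3"
  assumes P: "(P has_derivative (\<lambda>u. cross3 (\<omega> u) (P p))) (at p)"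
    and Q: "(Q has_derivative (\<lambda>u. cross3 (\<omega> u) (Q p))) (at p)"
    and on: "P p \<bullet> P p = 1" "Q p \<bullet> Q p = 1" "P p \<bullet> Q p = 0"
    and "(\<alpha> has_derivative \<alpha>') (at p)" "(\<beta> has_derivative \<beta>') (at p)"
      "(\<gamma> has_derivative \<gamma>') (at p)" "(\<delta> has_derivative \<delta>') (at p)"
    and C: "(C has_derivative C') (at p)"
      "\<forall>\<^sub>F q in nhds p. C q = cross3 (\<alpha> q *\<^sub>R P q + \<beta> q *\<^sub>R Q q) (\<gamma> q *\<^sub>R P q + \<delta> q *\<^sub>R Q q)"
  obtains x' y' where
    "((\<lambda>q. \<alpha> q *\<^sub>R P q + \<beta> q *\<^sub>R Q q) has_derivative x') (at p)"
    "((\<lambda>q. \<gamma> q *\<^sub>R P q + \<delta> q *\<^sub>R Q q) has_derivative y') (at p)"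
    "\<And>u v. y' u \<bullet> x' v - y' v \<bullet> x' u = \<gamma>' u * \<alpha>' v - \<gamma>' v * \<alpha>' u + (\<delta>' u * \<beta>' v - \<delta>' v * \<beta>' u)
       + spin_form \<omega> (C p) C' u v"
proof -
  define x y where "x q = \<alpha> q *\<^sub>R P q + \<beta> q *\<^sub>R Q q" and "y q = \<gamma> q *\<^sub>R P q + \<delta> q *\<^sub>R Q q" for q
  define a b where "a u = \<alpha>' u *\<^sub>R P p + \<beta>' u *\<^sub>R Q p" and "b u = \<gamma>' u *\<^sub>R P p + \<delta>' u *\<^sub>R Q p" for u
  define x' y' where "x' u = a u + cross3 (\<omega> u) (x p)" and "y' u = b u + cross3 (\<omega> u) (y p)" for u
  have x': "(x has_derivative x') (at p)"
    unfolding x_def x'_def a_def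
    by (rule has_derivative_eq_rhs, (rule derivative_intros assms)+)
      (simp add: fun_eq_iff cross_add_right cross_mult_right algebra_simps)
  have y': "(y has_derivative y') (at p)"
    unfolding y_def y'_def b_def
    by (rule has_derivative_eq_rhs, (rule derivative_intros assms)+)
      (simp add: fun_eq_iff cross_add_right cross_mult_right algebra_simps)
  \<comment> \<open>\<open>C'\<close> is given from outside; uniqueness of derivatives identifies it
    with the product rule for \<open>cross3 x y\<close>.\<close>
  have "((\<lambda>q. cross3 (x q) (y q)) has_derivative (\<lambda>u. cross3 (x p) (y' u) + cross3 (x' u) (y p))) (at p)"
    by (rule bounded_bilinear.FDERIV[OF bounded_bilinear_cross3 x' y'])
  moreover have Cxy: "\<forall>\<^sub>F q in nhds p. C q = cross3 (x q) (y q)"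
    using C(2) by (simp add: x_def y_def)
  then have "((\<lambda>q. cross3 (x q) (y q)) has_derivative C') (at p)"
    by (rule has_derivative_transform_nhds[OF C(1)])
  ultimately have C': "C' = (\<lambda>u. cross3 (x p) (y' u) + cross3 (x' u) (y p))"
    using has_derivative_unique by blast
  have Cp: "C p = cross3 (x p) (y p)"
    using eventually_nhds_x_imp_x[OF Cxy] .
  have ab: "b u \<bullet> a v = \<gamma>' u * \<alpha>' v + \<delta>' u * \<beta>' v" for u v
    using on by (simp add: a_def b_def inner_add_left inner_add_right inner_commute[of "Q p" "P p"])
  \<comment> \<open>The terms quadratic in \<open>\<omega>\<close> agree because, by the Jacobi
    identity, their part of \<open>C' u\<close> is \<open>cross3 (\<omega> u) (C p)\<close>.\<close>
  have id: "y' u \<bullet> x' v - y' v \<bullet> x' u = b u \<bullet> a v - b v \<bullet> a u + spin_form \<omega> (C p) C' u v" for u v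
    unfolding C' Cp spin_form_def x'_def y'_def by (simp add: cross3_simps)
  show thesis
    by (rule that[OF x'[unfolded x_def] y'[unfolded y_def]]) (simp add: id ab)
qed

text \<open>The defect \<open>X u = N' u - cross3 (\<omega> u) (N p)\<close> is orthogonal to both
  \<open>N p\<close> and \<open>P p\<close>, hence a multiple of their cross product. Such a defect
  is exactly what an additional rotation about \<open>P p\<close> produces.\<close>

lemma spinning_frame:
  fixes P N :: "'a::real_normed_vector \<Rightarrow> real ^ 3"
  assumes P: "(P has_derivative (\<lambda>u. cross3 (\<omega> u) (P p))) (at p)"
    and N: "(N has_derivative N') (at p)"
    and P1: "norm (P p) = 1" and N1: "\<forall>\<^sub>F q in nhds p. norm (N q) = 1"
    and NP: "\<forall>\<^sub>F q in nhds p. N q \<bullet> P q = 0"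
  obtains \<rho> where "N' = (\<lambda>u. cross3 (\<omega> u + \<rho> u *\<^sub>R P p) (N p))"
proof -
  have "((\<lambda>q. N q \<bullet> N q) has_derivative (\<lambda>u. 0)) (at p)"
    by (rule has_derivative_transform_nhds[OF has_derivative_const[of 1]])
      (use N1 in \<open>auto elim!: eventually_mono simp: norm_eq_1\<close>)
  moreover have "((\<lambda>q. N q \<bullet> N q) has_derivative (\<lambda>u. N p \<bullet> N' u + N' u \<bullet> N p)) (at p)"
    by (rule has_derivative_inner[OF N N])
  ultimately have "N p \<bullet> N' u + N' u \<bullet> N p = 0" for u
    by (rule fun_cong[OF has_derivative_unique, symmetric])
  then have N0: "N' u \<bullet> N p = 0" for u
    by (simp add: inner_commute)
  have "((\<lambda>q. N q \<bullet> P q) has_derivative (\<lambda>u. 0)) (at p)"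
    by (rule has_derivative_transform_nhds[OF has_derivative_const[of 0]])
      (use NP in \<open>auto elim!: eventually_mono\<close>)
  moreover have "((\<lambda>q. N q \<bullet> P q) has_derivative
      (\<lambda>u. N p \<bullet> cross3 (\<omega> u) (P p) + N' u \<bullet> P p)) (at p)"
    by (rule has_derivative_inner[OF N P])
  ultimately have P0: "N p \<bullet> cross3 (\<omega> u) (P p) + N' u \<bullet> P p = 0" for u
    by (rule fun_cong[OF has_derivative_unique, symmetric])
  define Q where "Q = cross3 (N p) (P p)"
  define X where "X u = N' u - cross3 (\<omega> u) (N p)" for u
  have "X u \<bullet> N p = 0" for u
    using N0[of u] by (simp add: X_def inner_diff_left dot_cross_self)
  moreover have "X u \<bullet> P p = 0" for u
    using P0[of u] unfolding X_def by (simp add: cross3_simps)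
  ultimately have "cross3 (X u) Q = 0" for u
    by (simp add: Q_def Lagrange)
  moreover have "cross3 Q (cross3 (X u) Q) = (Q \<bullet> Q) *\<^sub>R X u - (Q \<bullet> X u) *\<^sub>R Q" for u
    by (rule Lagrange)
  moreover have "Q \<bullet> Q = 1"
    using norm_cross_dot[of "N p" "P p"] P1 eventually_nhds_x_imp_x[OF N1]
      eventually_nhds_x_imp_x[OF NP]
    by (simp add: Q_def power2_norm_eq_inner)
  ultimately have X: "X u = (Q \<bullet> X u) *\<^sub>R Q" for u
    by simp
  show thesis
  proof (rule that[of "\<lambda>u. - (Q \<bullet> X u)"], rule ext)
    fix u
    have "N' u = cross3 (\<omega> u) (N p) + X u" by (simp add: X_def)
    also have "X u = (- (Q \<bullet> X u)) *\<^sub>R cross3 (P p) (N p)"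
      by (subst X) (simp add: Q_def cross_skew[of "P p" "N p"])
    finally show "N' u = cross3 (\<omega> u + (- (Q \<bullet> X u)) *\<^sub>R P p) (N p)"
      by (simp only: cross_add_left cross_mult_left)
  qed
qed

section \<open>Planar Kepler motion\<close>

text \<open>The eccentric anomaly as a function of two independent variables, so that an inverse
  function theorem in the plane applies.\<close>

definition kepler :: "real \<Rightarrow> real \<Rightarrow> real" where
  "kepler e l = (THE z. z - e * sin z = l)"

lemma kepler_equation:
  assumes "\<bar>e\<bar> < 1"
  shows "kepler e l - e * sin (kepler e l) = l"
  unfolding kepler_def by (rule theI'[OF kepler_unique[OF assms]])

lemma kepler_eqI:
  assumes "\<bar>e\<bar> < 1" "z - e * sin z = l"
  shows "kepler e l = z"
  unfolding kepler_def using assms by (intro the1_equality kepler_unique)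

lemma one_minus_e_cos_pos:
  fixes e z :: real
  assumes "\<bar>e\<bar> < 1"
  shows "0 < 1 - e * cos z"
proof -
  have "\<bar>e * cos z\<bar> \<le> \<bar>e\<bar>"
    using abs_cos_le_one[of z] by (simp add: abs_mult mult_left_le)
  then show ?thesis using assms by linarith
qed

text \<open>Carrying the eccentricity along turns Kepler's equation into the planar map
  \<open>f\<close>, which sends \<open>(e, z)\<close> to \<open>(e, z - e * sin z)\<close> and is
  inverted by \<open>g\<close> on the strip where \<open>e\<close> lies between -1 and 1. The
  inverse function theorem then gives the derivative of \<open>g\<close>.\<close>

lemma has_derivative_kepler:
  fixes e l :: "'a::real_normed_vector \<Rightarrow> real"
  assumes e: "(e has_derivative e') (at p)" and l: "(l has_derivative l') (at p)"
    and e1: "\<bar>e p\<bar> < 1" and z: "z = kepler (e p) (l p)"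
  shows "((\<lambda>q. kepler (e q) (l q)) has_derivative
    (\<lambda>u. (l' u + sin z * e' u) / (1 - e p * cos z))) (at p)"
proof -
  define f where "f x = (fst x, snd x - fst x * sin (snd x))" for x :: "real \<times> real"
  define g where "g x = (fst x, kepler (fst x) (snd x))" for x :: "real \<times> real"
  define r where "r = 1 - e p * cos z"
  have r: "r \<noteq> 0" using one_minus_e_cos_pos[OF e1, of z] by (simp add: r_def)
  define f' where "f' x = (fst x, snd x * r - fst x * sin z)" for x :: "real \<times> real"
  define g' where "g' x = (fst x, (snd x + sin z * fst x) / r)" for x :: "real \<times> real"
  have g: "g (e p, l p) = (e p, z)" by (simp add: g_def z)
  have "(g has_derivative g') (at (e p, l p))"
  proof (rule has_derivative_inverse_strong_x)
    show "open ({-1<..<1} \<times> UNIV :: (real \<times> real) set)"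
      by (intro open_Times) auto
    show "g (e p, l p) \<in> {-1<..<1} \<times> UNIV"
      using e1 by (auto simp: g)
    show "continuous_on ({-1<..<1} \<times> UNIV) f"
      unfolding f_def by (intro continuous_intros)
    show "g (f x) = x" if "x \<in> {-1<..<1} \<times> UNIV" for x
      using that by (auto simp: f_def g_def intro!: prod_eqI kepler_eqI)
    have "(f has_derivative f') (at (e p, z))"
      unfolding f_def f'_def
      by (rule derivative_eq_intros refl | simp add: r_def algebra_simps)+
    then show "(f has_derivative f') (at (g (e p, l p)))"
      by (simp add: g)
    show "f' \<circ> g' = id"
      using r by (auto simp: f'_def g'_def)
    show "f (g (e p, l p)) = (e p, l p)"
      using kepler_equation[OF e1] by (simp add: f_def g_def)
  qed
  then have "((\<lambda>q. g (e q, l q)) has_derivative (\<lambda>u. g' (e' u, l' u))) (at p)"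
    by (intro has_derivative_compose[OF has_derivative_Pair[OF e l]])
  from has_derivative_snd[OF this] show ?thesis
    by (simp add: g_def g'_def r_def)
qed

text \<open>
  With \<open>K = M m\<^sup>2\<close> the semi-major axis is \<open>L\<^sup>2 / K\<close>. The linear forms \<open>a, B, g, d\<close> are the differentials, in
  \<open>(L, e, z)\<close>, of the components \<open>x\<^sub>1, x\<^sub>2, y\<^sub>1, y\<^sub>2\<close> along the perihelion direction and its normal in the
  orbital plane, where \<open>s, c\<close> are the sine and cosine of the eccentric anomaly \<open>z\<close>.
\<close>

lemma planar_kepler_wedge_identity:
  fixes L K b :: real
  assumes nz: "L \<noteq> 0" "K \<noteq> 0" "b \<noteq> 0" "r \<noteq> 0"
    and sc: "s\<^sup>2 + c\<^sup>2 = 1" and b2: "b\<^sup>2 = 1 - e\<^sup>2" and r: "r = 1 - e * c"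
    and a: "a = (\<lambda>(l, f, z). L / K * (2 * (c - e) * l - L * f - L * s * z))"
    and B: "B = (\<lambda>(l, f, z). L / K * (2 * b * s * l - L * e * s / b * f + L * b * c * z))"
    and g: "g = (\<lambda>(l, f, z). K / (L\<^sup>2 * r\<^sup>2) * (s * r * l - L * s * c * f + L * (e - c) * z))"
    and d: "d = (\<lambda>(l, f, z). K / (L\<^sup>2 * r\<^sup>2) *
      (- (b * c * r) * l + L * c * (c - e) / b * f - L * b * s * z))"
  shows "g (l1, e1, z1) * a (l2, e2, z2) - g (l2, e2, z2) * a (l1, e1, z1)
      + (d (l1, e1, z1) * B (l2, e2, z2) - d (l2, e2, z2) * B (l1, e1, z1))
    = l1 * (z2 * r - e2 * s) - l2 * (z1 * r - e1 * s)"
proof -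
  \<comment> \<open>A name for \<open>1 / b\<close>, tied to \<open>b\<close> by
    \<open>b * f = 1\<close>, keeps the identities between the numerators polynomial.\<close>
  define f where "f = 1 / b"
  have bf: "b * f = 1" using nz by (simp add: f_def)
  define a0 where "a0 l f' z = 2 * (c - e) * l - L * f' - L * s * z" for l f' z
  define B0 where "B0 l f' z = 2 * b * s * l - L * e * s * f * f' + L * b * c * z" for l f' z
  define g0 where "g0 l f' z = s * r * l - L * s * c * f' + L * (e - c) * z" for l f' z
  define d0 where "d0 l f' z = - (b * c * r) * l + L * c * (c - e) * f * f' - L * b * s * z" for l f' z
  \<comment> \<open>These are the coefficients of dL \<and> dz, dL \<and> de and de \<and> dz, up to
    powers of \<open>L\<close>. The target dL \<and> (r dz - s de) dictates their values; in
    particular the last must vanish.\<close>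
  have 1: "- (s\<^sup>2) * r + 2 * (c - e)\<^sup>2 + (- (b * b) * c\<^sup>2 * r + 2 * (b * b) * s\<^sup>2) = r ^ 3"
    using sc b2 unfolding r by algebra
  have 2: "- (s * r) + 2 * (c - e) * s * c + (b * f) * (c * r * e * s - 2 * s * c * (c - e)) = - s * r\<^sup>2"
    using sc bf unfolding r by algebra
  have 3: "s * c * s + (e - c) + (b * f) * (c\<^sup>2 * (c - e) - e * s\<^sup>2) = 0"
    using sc bf by algebra
  have "g0 l1 e1 z1 * a0 l2 e2 z2 - g0 l2 e2 z2 * a0 l1 e1 z1
      + (d0 l1 e1 z1 * B0 l2 e2 z2 - d0 l2 e2 z2 * B0 l1 e1 z1)
    = L * (l1 * z2 - l2 * z1) * (- (s\<^sup>2) * r + 2 * (c - e)\<^sup>2 + (- (b * b) * c\<^sup>2 * r + 2 * (b * b) * s\<^sup>2))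
    + L * (l1 * e2 - l2 * e1) * (- (s * r) + 2 * (c - e) * s * c + (b * f) * (c * r * e * s - 2 * s * c * (c - e)))
    + L\<^sup>2 * (e1 * z2 - e2 * z1) * (s * c * s + (e - c) + (b * f) * (c\<^sup>2 * (c - e) - e * s\<^sup>2))"
    unfolding a0_def B0_def g0_def d0_def by algebra
  also have "\<dots> = L * r\<^sup>2 * (l1 * (z2 * r - e2 * s) - l2 * (z1 * r - e1 * s))"
    unfolding 1 2 3 by algebra
  finally have main: "g0 l1 e1 z1 * a0 l2 e2 z2 - g0 l2 e2 z2 * a0 l1 e1 z1
      + (d0 l1 e1 z1 * B0 l2 e2 z2 - d0 l2 e2 z2 * B0 l1 e1 z1)
    = L * r\<^sup>2 * (l1 * (z2 * r - e2 * s) - l2 * (z1 * r - e1 * s))" .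
  have eqs: "a (l, f', z) = L / K * a0 l f' z" "B (l, f', z) = L / K * B0 l f' z"
    "g (l, f', z) = K / (L\<^sup>2 * r\<^sup>2) * g0 l f' z" "d (l, f', z) = K / (L\<^sup>2 * r\<^sup>2) * d0 l f' z"
    for l f' z
    by (simp_all add: a B g d a0_def B0_def g0_def d0_def f_def)
  have "g (l1, e1, z1) * a (l2, e2, z2) - g (l2, e2, z2) * a (l1, e1, z1)
      + (d (l1, e1, z1) * B (l2, e2, z2) - d (l2, e2, z2) * B (l1, e1, z1))
    = (K / (L\<^sup>2 * r\<^sup>2)) * (L / K) * (g0 l1 e1 z1 * a0 l2 e2 z2 - g0 l2 e2 z2 * a0 l1 e1 z1
      + (d0 l1 e1 z1 * B0 l2 e2 z2 - d0 l2 e2 z2 * B0 l1 e1 z1))"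
    unfolding eqs by algebra
  also have "(K / (L\<^sup>2 * r\<^sup>2)) * (L / K) = 1 / (L * r\<^sup>2)"
    using nz by (simp add: power2_eq_square)
  finally show ?thesis unfolding main using nz by simp
qed

text \<open>\<open>l'\<close> is the differential of the mean anomaly \<open>z - e * sin z\<close>.
  With the perihelion direction frozen, only the pair of \<open>L\<close> and the mean anomaly
  survives from the Delaunay form, although the eccentricity varies freely.\<close>

lemma planar_kepler_wedge:
  fixes L e z :: "'a::real_normed_vector \<Rightarrow> real"
  assumes L: "(L has_derivative L') (at p)" and e: "(e has_derivative e') (at p)"
    and z: "(z has_derivative z') (at p)"
    and L0: "L p \<noteq> 0" and K: "K \<noteq> 0" and e1: "\<bar>e p\<bar> < 1"
    and l: "\<And>u. l' u = z' u * (1 - e p * cos (z p)) - e' u * sin (z p)"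
  obtains \<alpha> \<beta> \<gamma> \<delta> where
    "((\<lambda>q. (L q)\<^sup>2 / K * (cos (z q) - e q)) has_derivative \<alpha>) (at p)"
    "((\<lambda>q. (L q)\<^sup>2 / K * sqrt (1 - (e q)\<^sup>2) * sin (z q)) has_derivative \<beta>) (at p)"
    "((\<lambda>q. - (K / L q) * (sin (z q) / (1 - e q * cos (z q)))) has_derivative \<gamma>) (at p)"
    "((\<lambda>q. K / L q * sqrt (1 - (e q)\<^sup>2) * (cos (z q) / (1 - e q * cos (z q)))) has_derivative \<delta>) (at p)"
    "\<And>u v. \<gamma> u * \<alpha> v - \<gamma> v * \<alpha> u + (\<delta> u * \<beta> v - \<delta> v * \<beta> u) = L' u * l' v - L' v * l' u"
proof -
  define c s b r where "c = cos (z p)" and "s = sin (z p)" and "b = sqrt (1 - (e p)\<^sup>2)"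
    and "r = 1 - e p * c"
  have e2: "(e p)\<^sup>2 < 1" using e1 by (simp add: abs_square_less_1)
  have b: "b > 0" "b\<^sup>2 = 1 - (e p)\<^sup>2" using e2 by (simp_all add: b_def)
  have r: "r > 0" using one_minus_e_cos_pos[OF e1] by (simp add: r_def c_def)
  have sc: "s\<^sup>2 + c\<^sup>2 = 1" by (simp add: s_def c_def)
  let ?L = "L p" and ?e = "e p"
  define a where "a = (\<lambda>(l, f, z). ?L / K * (2 * (c - ?e) * l - ?L * f - ?L * s * z))"
  define B where "B = (\<lambda>(l, f, z). ?L / K * (2 * b * s * l - ?L * ?e * s / b * f + ?L * b * c * z))"
  define g where "g = (\<lambda>(l, f, z). K / (?L\<^sup>2 * r\<^sup>2) * (s * r * l - ?L * s * c * f + ?L * (?e - c) * z))"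
  define d where "d = (\<lambda>(l, f, z). K / (?L\<^sup>2 * r\<^sup>2) *
      (- (b * c * r) * l + ?L * c * (c - ?e) / b * f - ?L * b * s * z))"
  have db: "((\<lambda>q. sqrt (1 - (e q)\<^sup>2)) has_derivative (\<lambda>u. - ?e * e' u / b)) (at p)"
    using e2 b(1) by (auto intro!: derivative_eq_intros e simp: b_def field_simps)
  have dr: "((\<lambda>q. 1 - e q * cos (z q)) has_derivative (\<lambda>u. - c * e' u + ?e * s * z' u)) (at p)"
    by (rule derivative_eq_intros e z refl | simp add: c_def s_def algebra_simps)+
  have ds: "((\<lambda>q. sin (z q)) has_derivative (\<lambda>u. c * z' u)) (at p)"
    and dc: "((\<lambda>q. cos (z q)) has_derivative (\<lambda>u. - s * z' u)) (at p)"
    by (rule derivative_eq_intros z refl | simp add: c_def s_def algebra_simps)+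
  have dK: "((\<lambda>q. K / L q) has_derivative (\<lambda>u. - K * L' u / ?L\<^sup>2)) (at p)"
    using L0 by (auto intro!: derivative_eq_intros L simp: field_simps power2_eq_square)
  have dL: "((\<lambda>q. (L q)\<^sup>2 / K) has_derivative (\<lambda>u. 2 * ?L * L' u / K)) (at p)"
    using K by (auto intro!: derivative_eq_intros L simp: field_simps power2_eq_square)
  have quot: "((\<lambda>q. f q / (1 - e q * cos (z q))) has_derivative
      (\<lambda>u. (f' u * r - f p * (- c * e' u + ?e * s * z' u)) / r\<^sup>2)) (at p)"
    if "(f has_derivative f') (at p)" for f f'
  proof (rule has_derivative_eq_rhs[OF has_derivative_divide[OF that dr]])
    show "1 - ?e * cos (z p) \<noteq> 0" using r by (simp add: r_def c_def)
    have "- x * (inverse r * y * inverse r) + x' / r = (x' * r - x * y) / r\<^sup>2" for x y x' :: real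
      using r by (simp add: field_simps power2_eq_square)
    then show "(\<lambda>u. - f p * (inverse (1 - ?e * cos (z p)) * (- c * e' u + ?e * s * z' u) *
        inverse (1 - ?e * cos (z p))) + f' u / (1 - ?e * cos (z p))) =
      (\<lambda>u. (f' u * r - f p * (- c * e' u + ?e * s * z' u)) / r\<^sup>2)"
      unfolding c_def[symmetric] r_def[symmetric] by simp
  qed
  have "((\<lambda>q. (L q)\<^sup>2 / K * (cos (z q) - e q)) has_derivative (\<lambda>u. a (L' u, e' u, z' u))) (at p)"
    by (rule has_derivative_eq_rhs[OF has_derivative_mult[OF dL has_derivative_diff[OF dc e]]])
      (use K in \<open>simp add: a_def fun_eq_iff c_def field_simps power2_eq_square\<close>)
  moreover have "((\<lambda>q. (L q)\<^sup>2 / K * sqrt (1 - (e q)\<^sup>2) * sin (z q)) has_derivative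
      (\<lambda>u. B (L' u, e' u, z' u))) (at p)"
    by (rule has_derivative_eq_rhs[OF has_derivative_mult[OF has_derivative_mult[OF dL db] ds]])
      (simp only: s_def[symmetric] b_def[symmetric],
        use K b in \<open>simp add: B_def fun_eq_iff field_simps power2_eq_square\<close>)
  moreover have "((\<lambda>q. - (K / L q) * (sin (z q) / (1 - e q * cos (z q)))) has_derivative
      (\<lambda>u. g (L' u, e' u, z' u))) (at p)"
  proof (rule has_derivative_eq_rhs[OF has_derivative_mult[OF has_derivative_minus[OF dK] quot[OF ds]]], rule ext)
    fix u
    show "- (K / L p) * ((c * z' u * r - sin (z p) * (- c * e' u + ?e * s * z' u)) / r\<^sup>2)
        + - (- K * L' u / ?L\<^sup>2) * (sin (z p) / (1 - ?e * cos (z p))) = g (L' u, e' u, z' u)"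
      (is "?l = _")
    proof -
      have "?l = K / (?L\<^sup>2 * r\<^sup>2) * (s * r * L' u - ?L * s * c * e' u - ?L * (c * r - s * (?e * s)) * z' u)"
        unfolding s_def[symmetric] c_def[symmetric] r_def[symmetric]
        using L0 r by (simp add: field_simps power2_eq_square)
      also have "c * r - s * (?e * s) = c - ?e" using sc unfolding r_def by algebra
      also have "K / (?L\<^sup>2 * r\<^sup>2) * (s * r * L' u - ?L * s * c * e' u - ?L * (c - ?e) * z' u) =
          g (L' u, e' u, z' u)"
        unfolding g_def prod.case by (rule arg_cong[where f = "(*) _"]) algebra
      finally show ?thesis .
    qed
  qed
  moreover have "((\<lambda>q. K / L q * sqrt (1 - (e q)\<^sup>2) * (cos (z q) / (1 - e q * cos (z q)))) has_derivative
      (\<lambda>u. d (L' u, e' u, z' u))) (at p)"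
  proof (rule has_derivative_eq_rhs[OF has_derivative_mult[OF has_derivative_mult[OF dK db] quot[OF dc]]], rule ext)
    fix u
    show "(K / ?L * sqrt (1 - ?e\<^sup>2)) * ((- s * z' u * r - cos (z p) * (- c * e' u + ?e * s * z' u)) / r\<^sup>2)
        + (K / ?L * (- ?e * e' u / b) + - K * L' u / ?L\<^sup>2 * sqrt (1 - ?e\<^sup>2)) * (cos (z p) / (1 - ?e * cos (z p)))
        = d (L' u, e' u, z' u)"
      (is "?l = _")
    proof -
      have "?l = K / (?L\<^sup>2 * r\<^sup>2) * (- (b * c * r) * L' u + ?L * ((b\<^sup>2 * c\<^sup>2 - ?e * c * r) / b) * e' u
          - ?L * b * (s * (r + ?e * c)) * z' u)"
        unfolding s_def[symmetric] c_def[symmetric] r_def[symmetric] b_def[symmetric]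
        using L0 r b(1) by (simp add: field_simps power2_eq_square)
      also have "b\<^sup>2 * c\<^sup>2 - ?e * c * r = c * (c - ?e)" unfolding r_def b(2) by algebra
      also have "r + ?e * c = 1" by (simp add: r_def)
      finally show ?thesis by (simp add: d_def)
    qed
  qed
  moreover have "g (L' u, e' u, z' u) * a (L' v, e' v, z' v) - g (L' v, e' v, z' v) * a (L' u, e' u, z' u)
      + (d (L' u, e' u, z' u) * B (L' v, e' v, z' v) - d (L' v, e' v, z' v) * B (L' u, e' u, z' u))
      = L' u * l' v - L' v * l' u" for u v
    unfolding l c_def[symmetric] s_def[symmetric] r_def[symmetric]
    using L0 K b r by (intro planar_kepler_wedge_identity[OF _ _ _ _ sc b(2) r_def a_def B_def g_def d_def]) auto
  ultimately show thesis by (rule that)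
qed

section \<open>The chain of rotations\<close>

text \<open>The coordinates are linear functionals and hence their own differentials; below,
  \<open>vtheta j u\<close> stands for the value of d\<vartheta> on \<open>u\<close>, and likewise
  for the others.\<close>

lemma coordinate_has_derivative:
  "(Theta i has_derivative Theta i) F" "(chi i has_derivative chi i) F"
  "(Lam i has_derivative Lam i) F" "(vtheta i has_derivative vtheta i) F"
  "(kappa i has_derivative kappa i) F" "(ell i has_derivative ell i) F"
proof -
  have lin: "linear (Theta i)" "linear (chi i)" "linear (Lam i)" "linear (vtheta i)"
    "linear (kappa i)" "linear (ell i)"
    by (auto intro!: linearI simp: Theta_def chi_def Lam_def vtheta_def kappa_def ell_def entry_def)
  show "(Theta i has_derivative Theta i) F" "(chi i has_derivative chi i) F"
    "(Lam i has_derivative Lam i) F" "(vtheta i has_derivative vtheta i) F"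
    "(kappa i has_derivative kappa i) F" "(ell i has_derivative ell i) F"
    using lin by (auto intro: linear_imp_has_derivative)
qed

lemma coordinate_tendsto:
  "(Theta i \<longlongrightarrow> Theta i p) (nhds p)" "(chi i \<longlongrightarrow> chi i p) (nhds p)"
  "(Lam i \<longlongrightarrow> Lam i p) (nhds p)"
proof -
  have "isCont (Theta i) p" "isCont (chi i) p" "isCont (Lam i) p"
    by (auto intro: has_derivative_continuous coordinate_has_derivative)
  then show "(Theta i \<longlongrightarrow> Theta i p) (nhds p)" "(chi i \<longlongrightarrow> chi i p) (nhds p)"
    "(Lam i \<longlongrightarrow> Lam i p) (nhds p)"
    by (simp_all add: isCont_def tendsto_at_iff_tendsto_nhds)
qed

lemma d_form_coordinate:
  "d_form (Theta i) p = Theta i" "d_form (chi i) p = chi i" "d_form (Lam i) p = Lam i"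
  "d_form (vtheta i) p = vtheta i" "d_form (kappa i) p = kappa i" "d_form (ell i) p = ell i"
  unfolding d_form_def
  by (rule frechet_derivative_at[OF coordinate_has_derivative(1), symmetric]
      frechet_derivative_at[OF coordinate_has_derivative(2), symmetric]
      frechet_derivative_at[OF coordinate_has_derivative(3), symmetric]
      frechet_derivative_at[OF coordinate_has_derivative(4), symmetric]
      frechet_derivative_at[OF coordinate_has_derivative(5), symmetric]
      frechet_derivative_at[OF coordinate_has_derivative(6), symmetric])+

section \<open>Inclinations and their differentiability\<close>

lemma Theta_CARD: "Theta (CARD('n)) (p :: 'n::finite point) = 0"
  and chi_CARD: "chi (CARD('n)) (p :: 'n::finite point) = 0"
  by (auto simp: Theta_def chi_def)

text \<open>These bounds keep both inclinations of each step strictly between 0 and \<pi>, where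
  \<open>arccos\<close> is differentiable.\<close>

lemma P_dom_abs_Theta_less:
  fixes p :: "'n::finite point"
  assumes p: "p \<in> P_dom" and i: "i < CARD('n)"
  shows "\<bar>Theta i p\<bar> < chi i p" "\<bar>Theta (Suc i) p\<bar> < chi i p"
proof -
  have *: "\<bar>Theta k p\<bar> < min (chi (k - 1) p) (chi k p)" if "k \<in> {1..CARD('n) - 1}" for k
    using p that by (auto simp: P_dom_def Let_def)
  show "\<bar>Theta i p\<bar> < chi i p"
    using *[of i] p i by (cases "i = 0") (auto simp: P_dom_def Let_def)
  have "0 < chi i p" using p i by (auto simp: P_dom_def Let_def)
  \<comment> \<open>At the last index the convention \<open>Theta n = 0\<close> reduces the bound to
    positivity of \<open>chi\<close>.\<close>
  then show "\<bar>Theta (Suc i) p\<bar> < chi i p"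
    using *[of "Suc i"] i by (cases "Suc i = CARD('n)") (auto simp: Theta_CARD)
qed

lemma eventually_abs_Theta_less:
  assumes "\<bar>Theta i p\<bar> < chi j p"
  shows "\<forall>\<^sub>F q in nhds p. \<bar>Theta i q\<bar> < chi j q"
  using order_tendstoD(1)[OF tendsto_diff[OF coordinate_tendsto(2)[of j p]
    tendsto_rabs[OF coordinate_tendsto(1)[of i p]]], of 0] assms
  by simp

text \<open>\<open>inclination j j\<close> and \<open>inclination (Suc j) j\<close> are the two
  inclinations of step j + 1, those in \<open>T_mat (Suc j)\<close> and
  \<open>S_mat (Suc j)\<close>.\<close>

definition inclination :: "nat \<Rightarrow> nat \<Rightarrow> 'n::finite point \<Rightarrow> real" where
  "inclination i j p = arccos (Theta i p / chi j p)"

lemma abs_Theta_div_less_1: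
  assumes "\<bar>Theta i p\<bar> < chi j p"
  shows "- 1 < Theta i p / chi j p" "Theta i p / chi j p < 1"
  using assms by (auto simp: field_simps)

lemma chi_cos_inclination:
  assumes "\<bar>Theta i p\<bar> < chi j p"
  shows "chi j p * cos (inclination i j p) = Theta i p"
  using abs_Theta_div_less_1[OF assms] assms by (simp add: inclination_def)

text \<open>The differential stays abstract: it multiplies node-line axes orthogonal to
  \<open>partial_C j\<close>, so its value never enters the result.\<close>

lemma inclination_has_derivative:
  assumes "\<bar>Theta i p\<bar> < chi j p"
  shows "(inclination i j has_derivative d_form (inclination i j) p) (at p)"
proof -
  have "((\<lambda>q. Theta i q / chi j q) has_derivative
      (\<lambda>u. - Theta i p * (inverse (chi j p) * chi j u * inverse (chi j p)) + Theta i u / chi j p)) (at p)"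
    using assms by (intro has_derivative_divide coordinate_has_derivative) auto
  from has_derivative_arccos[OF _ _ this] abs_Theta_div_less_1[OF assms]
  have "(inclination i j) differentiable (at p)"
    unfolding differentiable_def inclination_def by blast
  then show ?thesis
    unfolding d_form_def by (simp add: frechet_derivative_works)
qed

lemma T_mat_eq: "T_mat (Suc j) p = R3 (vtheta j p) ** R1 (inclination j j p)"
  and S_mat_eq: "S_mat (Suc j) p = R3 (kappa j p) ** R1 (inclination (Suc j) j p)"
  by (simp_all add: T_mat_def S_mat_def inclination_def)

lemma k3_inner_R3_R1: "k3 \<bullet> ((R3 t ** R1 i) *v k3) = cos i"
  by (simp add: k3_def inner_vec_def R1_def R3_def matrix_matrix_mult_def
      matrix_vector_mult_def sum_3 vector_3 axis_def)

lemma inner_orthogonal_matrix: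
  fixes A :: "real ^ 3 ^ 3"
  assumes "orthogonal_matrix A"
  shows "(A *v v) \<bullet> (A *v w) = v \<bullet> w"
proof -
  have "orthogonal_transformation ((*v) A)"
    using assms by (simp add: orthogonal_transformation_matrix matrix_of_matrix_vector_mul)
  then show ?thesis by (simp add: orthogonal_transformation_def)
qed

text \<open>Each step adds the rates of its four elementary rotations, every axis being carried by
  the rotations to its left.\<close>

primrec angular_velocity :: "nat \<Rightarrow> 'n::finite point \<Rightarrow> 'n point \<Rightarrow> real ^ 3" where
  "angular_velocity 0 p = (\<lambda>u. 0)"
| "angular_velocity (Suc j) p = (\<lambda>u. angular_velocity j p u
    + vtheta j u *\<^sub>R (TS_prod j p *v k3)
    + d_form (inclination j j) p u *\<^sub>R ((TS_prod j p ** R3 (vtheta j p)) *v axis 1 1)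
    + kappa j u *\<^sub>R ((TS_prod j p ** T_mat (Suc j) p) *v k3)
    + d_form (inclination (Suc j) j) p u *\<^sub>R
        ((TS_prod j p ** T_mat (Suc j) p ** R3 (kappa j p)) *v axis 1 1))"

text \<open>\<open>partial_C j\<close> is the sum of the angular momenta of the bodies \<open>j + 1, \<dots>, n\<close>.\<close>

definition partial_C :: "nat \<Rightarrow> 'n::finite point \<Rightarrow> real ^ 3" where
  "partial_C j p = chi j p *\<^sub>R ((TS_prod j p ** T_mat (Suc j) p) *v k3)"

text \<open>The convention \<open>chi n = 0\<close> absorbs the case distinction for the last body,
  which is what lets the sum over the bodies telescope.\<close>

lemma C_vec_eq_partial_C_diff:
  fixes p :: "'n::finite point"
  assumes "Suc j \<le> CARD('n)"
  shows "C_vec (Suc j) p = partial_C j p - partial_C (Suc j) p"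
  by (auto simp: C_vec_def partial_C_def chi_CARD matrix_vector_mult_diff_distrib
      matrix_vector_mult_scaleR matrix_vector_mul_assoc matrix_mul_assoc)

text \<open>Each elementary rotation adds dh \<and> d\<phi>, where \<phi> is its angle and h the
  component of \<open>partial_C j\<close> along its axis. In order, the four components are
  \<open>Theta j\<close>, 0, \<open>chi j\<close> and 0.\<close>

lemma TS_prod_step:
  fixes p :: "'n::finite point"
  assumes p: "p \<in> P_dom" and j: "j < CARD('n)"
    and A: "spins (TS_prod j) (angular_velocity j p) p"
  obtains W where
    "spins (TS_prod (Suc j)) (angular_velocity (Suc j) p) p"
    "(partial_C j has_derivative W) (at p)"
    "\<And>u v. spin_form (angular_velocity (Suc j) p) (partial_C j p) W u v
      = spin_form (angular_velocity j p) (partial_C j p) W u v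
        + (Theta j u * vtheta j v - Theta j v * vtheta j u)
        + (chi j u * kappa j v - chi j v * kappa j u)"
proof -
  note lt = P_dom_abs_Theta_less[OF p j]
  define A1 A2 A3 where "A1 q = TS_prod j q ** R3 (vtheta j q)"
    and "A2 q = A1 q ** R1 (inclination j j q)" and "A3 q = A2 q ** R3 (kappa j q)" for q :: "'n point"
  define \<omega>1 where "\<omega>1 = (\<lambda>u. angular_velocity j p u + vtheta j u *\<^sub>R (TS_prod j p *v k3))"
  define \<omega>2 where "\<omega>2 = (\<lambda>u. \<omega>1 u + d_form (inclination j j) p u *\<^sub>R (A1 p *v axis 1 1))"
  define \<omega>3 where "\<omega>3 = (\<lambda>u. \<omega>2 u + kappa j u *\<^sub>R (A2 p *v k3))"
  define \<omega>4 where "\<omega>4 = (\<lambda>u. \<omega>3 u + d_form (inclination (Suc j) j) p u *\<^sub>R (A3 p *v axis 1 1))"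
  have A2: "A2 q = TS_prod j q ** T_mat (Suc j) q" for q
    by (simp add: A2_def A1_def T_mat_eq matrix_mul_assoc)
  have A4: "TS_prod (Suc j) = (\<lambda>q. A3 q ** R1 (inclination (Suc j) j q))"
    by (simp add: fun_eq_iff A3_def A2 S_mat_eq matrix_mul_assoc)
  have \<omega>4: "angular_velocity (Suc j) p = \<omega>4"
    by (simp add: \<omega>4_def \<omega>3_def \<omega>2_def \<omega>1_def A3_def A2 A1_def)
  have s1: "spins A1 \<omega>1 p"
    unfolding A1_def \<omega>1_def
    by (intro spins_mult_axis A R3_one_parameter_rotation coordinate_has_derivative)
  have s2: "spins A2 \<omega>2 p"
    unfolding A2_def \<omega>2_def
    by (intro spins_mult_axis s1 R1_one_parameter_rotation inclination_has_derivative lt)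
  have s3: "spins A3 \<omega>3 p"
    unfolding A3_def \<omega>3_def
    by (intro spins_mult_axis s2 R3_one_parameter_rotation coordinate_has_derivative)
  have s4: "spins (TS_prod (Suc j)) (angular_velocity (Suc j) p) p"
    unfolding A4 \<omega>4 \<omega>4_def
    by (intro spins_mult_axis s3 R1_one_parameter_rotation inclination_has_derivative lt)
  have W_eq: "partial_C j q = chi j q *\<^sub>R (A2 q *v k3)" for q
    by (simp add: partial_C_def A2)
  obtain W where W: "(partial_C j has_derivative W) (at p)"
    using has_derivative_scaleR[OF coordinate_has_derivative(2)[of j "at p"]] s2
    unfolding spins_def W_eq[abs_def] by blast
  have orth: "orthogonal_matrix (TS_prod j q)" "orthogonal_matrix (A1 q)" "orthogonal_matrix (A2 q)" for q
    by (simp_all add: A1_def A2_def orthogonal_matrix_mul R1_orthogonal R3_orthogonal TS_prod_orthogonal)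
  \<comment> \<open>\<open>R1\<close> turns \<open>k3\<close> within the plane orthogonal to its own
    axis, and \<open>R3\<close> keeps the first axis in the plane orthogonal to \<open>k3\<close>.
    Hence both node lines are orthogonal to \<open>partial_C j\<close>.\<close>
  have k3: "axis 1 1 \<bullet> (R1 i *v k3) = 0"
    "k3 \<bullet> k3 = 1" "(R3 t *v axis 1 1) \<bullet> k3 = 0" for t i
    by (simp_all add: k3_def inner_vec_def R1_def R3_def matrix_matrix_mult_def
        matrix_vector_mult_def sum_3 vector_3 axis_def)
  have h1: "((\<lambda>q. (TS_prod j q *v k3) \<bullet> partial_C j q) has_derivative Theta j) (at p)"
  \<comment> \<open>The component is \<open>chi j\<close> times the cosine of the inclination, which
    equals \<open>Theta j\<close> as long as the argument of \<open>arccos\<close> is admissible;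
    this holds near \<open>p\<close>.\<close>
  proof (rule has_derivative_transform_nhds[OF coordinate_has_derivative(1)])
    show "\<forall>\<^sub>F q in nhds p. Theta j q = (TS_prod j q *v k3) \<bullet> partial_C j q"
      using eventually_abs_Theta_less[OF lt(1)]
    proof eventually_elim
      case (elim q)
      have "partial_C j q = chi j q *\<^sub>R (TS_prod j q *v ((R3 (vtheta j q) ** R1 (inclination j j q)) *v k3))"
        by (simp add: W_eq A2_def A1_def matrix_vector_mul_assoc matrix_mul_assoc)
      then show ?case
        by (simp add: inner_orthogonal_matrix orth k3_inner_R3_R1 chi_cos_inclination[OF elim])
    qed
  qed
  have h2: "((\<lambda>q. (A1 q *v axis 1 1) \<bullet> partial_C j q) has_derivative (\<lambda>u. 0)) (at p)"
  proof -
    have "(A1 q *v axis 1 1) \<bullet> partial_C j q = 0" for q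
      by (simp add: W_eq A2_def inner_orthogonal_matrix orth k3 flip: matrix_vector_mul_assoc)
    then show ?thesis by simp
  qed
  have h3: "((\<lambda>q. (A2 q *v k3) \<bullet> partial_C j q) has_derivative chi j) (at p)"
  proof -
    have "(A2 q *v k3) \<bullet> partial_C j q = chi j q" for q
      by (simp add: W_eq inner_orthogonal_matrix orth k3)
    then show ?thesis by (simp add: coordinate_has_derivative)
  qed
  have h4: "((\<lambda>q. (A3 q *v axis 1 1) \<bullet> partial_C j q) has_derivative (\<lambda>u. 0)) (at p)"
  proof -
    have "(A3 q *v axis 1 1) \<bullet> partial_C j q = 0" for q
      by (simp add: W_eq A3_def inner_orthogonal_matrix orth k3 flip: matrix_vector_mul_assoc)
    then show ?thesis by simp
  qed
  have axis: "((\<lambda>q. B q *v k) has_derivative (\<lambda>u. cross3 (\<omega> u) (B p *v k))) (at p)"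
    if "spins B \<omega> p" for B \<omega> k
    using that by (auto simp: spins_def)
  have "spin_form \<omega>1 (partial_C j p) W u v = spin_form (angular_velocity j p) (partial_C j p) W u v
      + (Theta j u * vtheta j v - Theta j v * vtheta j u)" for u v
    unfolding \<omega>1_def by (rule spin_form_add_axis[OF axis[OF A] W h1])
  moreover have "spin_form \<omega>2 (partial_C j p) W u v = spin_form \<omega>1 (partial_C j p) W u v" for u v
    unfolding \<omega>2_def using spin_form_add_axis[OF axis[OF s1] W h2] by simp
  moreover have "spin_form \<omega>3 (partial_C j p) W u v = spin_form \<omega>2 (partial_C j p) W u v
      + (chi j u * kappa j v - chi j v * kappa j u)" for u v
    unfolding \<omega>3_def by (rule spin_form_add_axis[OF axis[OF s2] W h3])
  moreover have "spin_form \<omega>4 (partial_C j p) W u v = spin_form \<omega>3 (partial_C j p) W u v" for u v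
    unfolding \<omega>4_def using spin_form_add_axis[OF axis[OF s3] W h4] by simp
  ultimately show thesis
    by (intro that[OF s4 W]) (simp only: \<omega>4)
qed

lemma TS_prod_spins:
  fixes p :: "'n::finite point"
  assumes p: "p \<in> P_dom" and j: "j \<le> CARD('n)"
  shows "spins (TS_prod j) (angular_velocity j p) p"
  using j
proof (induction j)
  case 0
  then show ?case
    by (simp add: spins_def rotation_matrix_def orthogonal_matrix_id)
next
  case (Suc j)
  then show ?case
    using TS_prod_step[OF p, of j] by (metis Suc_le_lessD Suc_leD)
qed

section \<open>Orbits in moving frames\<close>

lemma zeta_eq_kepler: "zeta j p = kepler (ecc j p) (ell j p)"
  by (simp add: zeta_def kepler_def)

text \<open>The hypotheses are bounds on the angular momentum rather than membership in
  \<open>P_dom\<close>, since by continuity they persist at all points near a point of the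
  domain.\<close>

lemma ecc_of_norm_C_vec:
  assumes "0 < norm (C_vec j q)" "norm (C_vec j q) < Lam j q"
  shows "0 < 1 - (norm (C_vec j q))\<^sup>2 / (Lam j q)\<^sup>2" "\<bar>ecc j q\<bar> < 1"
    "sqrt (1 - (ecc j q)\<^sup>2) = norm (C_vec j q) / Lam j q"
proof -
  let ?x = "(norm (C_vec j q))\<^sup>2 / (Lam j q)\<^sup>2"
  have L: "0 < Lam j q" using assms by linarith
  have "(norm (C_vec j q))\<^sup>2 < (Lam j q)\<^sup>2"
    using assms by (intro power_strict_mono) auto
  then have x: "?x < 1" "0 < ?x" using assms(1) L by simp_all
  then show "0 < 1 - ?x" by simp
  show "\<bar>ecc j q\<bar> < 1"
    using x by (simp add: ecc_def)
  have "1 - (ecc j q)\<^sup>2 = ?x" using x by (simp add: ecc_def)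
  then show "sqrt (1 - (ecc j q)\<^sup>2) = norm (C_vec j q) / Lam j q"
    using L by (simp add: real_sqrt_divide)
qed

text \<open>Position and momentum on the ellipse have angular momentum of length
  \<open>L * b\<close>, because the factor \<open>1 - e * cos z\<close> cancels. The choice
  \<open>b = norm C / L\<close> makes this \<open>norm C\<close>. The identity supplies the
  hypothesis on \<open>C\<close> in \<open>wedge_spinning_frame\<close>.\<close>

lemma angular_momentum_in_orbital_frame:
  fixes P C :: "real ^ 3"
  assumes C: "C \<noteq> 0" and P: "norm P = 1" and CP: "C \<bullet> P = 0"
    and L: "0 < L" and K: "0 < K" and e: "\<bar>e\<bar> < 1" and b: "b = norm C / L"
    and N: "N = C /\<^sub>R norm C"
  shows "cross3 ((L\<^sup>2 / K * (cos z - e)) *\<^sub>R P + (L\<^sup>2 / K * b * sin z) *\<^sub>R cross3 N P)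
      ((- (K / L) * (sin z / (1 - e * cos z))) *\<^sub>R P
        + (K / L * b * (cos z / (1 - e * cos z))) *\<^sub>R cross3 N P) = C"
proof -
  define r where "r = 1 - e * cos z"
  have r: "r > 0" using one_minus_e_cos_pos[OF e] by (simp add: r_def)
  have "P \<bullet> P = 1" "P \<bullet> N = 0"
    using P CP by (simp_all add: norm_eq_1 N inner_commute)
  then have PQ: "cross3 P (cross3 N P) = N"
    by (simp add: Lagrange)
  then have QP: "cross3 (cross3 N P) P = - N"
    by (simp add: cross_skew[of "cross3 N P" P])
  have comb: "cross3 (x *\<^sub>R P + y *\<^sub>R cross3 N P) (x' *\<^sub>R P + y' *\<^sub>R cross3 N P)
      = (x * y' - y * x') *\<^sub>R N" for x y x' y'
    by (simp add: cross_add_left cross_add_right cross_mult_left cross_mult_right PQ QP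
        scaleR_diff_left mult.commute)
  have "(L\<^sup>2 / K * (c - e)) * (K / L * b * (c / r)) - (L\<^sup>2 / K * b * s) * (- (K / L) * (s / r))
      = L * b * ((c\<^sup>2 + s\<^sup>2 - e * c) / r)" for c s
    using L K r by (simp add: field_simps power2_eq_square)
  then have "(L\<^sup>2 / K * (cos z - e)) * (K / L * b * (cos z / r))
      - (L\<^sup>2 / K * b * sin z) * (- (K / L) * (sin z / r))
      = L * b * (((cos z)\<^sup>2 + (sin z)\<^sup>2 - e * cos z) / r)" .
  also have "((cos z)\<^sup>2 + (sin z)\<^sup>2 - e * cos z) / r = 1"
    using r by (simp add: r_def)
  also have "L * b * 1 = norm C" using L by (simp add: b)
  finally show ?thesis
    unfolding comb r_def[symmetric] using C by (simp only: N) simp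
qed

text \<open>The planar Kepler form and the turning orbital frame are combined here, with the angular
  velocity of the orbital frame traded for that of \<open>TS_prod j\<close>.\<close>

lemma body_has_derivative:
  fixes p :: "'n::finite point"
  assumes p: "p \<in> P_dom" and j: "j \<in> {1..CARD('n)}" and m: "0 < m j" and M: "0 < M j"
    and C: "(C_vec j has_derivative C') (at p)"
    and CP: "\<forall>\<^sub>F q in nhds p. C_vec j q \<bullet> Peri j q = 0"
    and A: "spins (TS_prod j) \<Omega> p"
  obtains x y where
    "(x_P m M j has_derivative x) (at p)" "(y_P m M j has_derivative y) (at p)"
    "\<And>u v. y u \<bullet> x v - y v \<bullet> x u =
      Lam j u * ell j v - Lam j v * ell j u + spin_form \<Omega> (C_vec j p) C' u v"
proof -
  note C0 = C_vec_bounds[OF p j]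
  have Cpos: "0 < norm (C_vec j p)" using C0 by simp
  have Lp: "0 < Lam j p" using C0(2) norm_ge_zero[of "C_vec j p"] by linarith
  have contC: "(C_vec j \<longlongrightarrow> C_vec j p) (nhds p)"
    using has_derivative_continuous[OF C] by (simp add: isCont_def tendsto_at_iff_tendsto_nhds)
  have evC: "\<forall>\<^sub>F q in nhds p. 0 < norm (C_vec j q)"
    by (rule order_tendstoD(1)[OF tendsto_norm[OF contC] Cpos])
  have evL: "\<forall>\<^sub>F q in nhds p. norm (C_vec j q) < Lam j q"
    using order_tendstoD(1)[OF tendsto_diff[OF coordinate_tendsto(3) tendsto_norm[OF contC]], of 0] C0(2)
    by simp
  define K where "K = M j * (m j)\<^sup>2"
  have K: "0 < K" using m M by (simp add: K_def)
  note e1 = ecc_of_norm_C_vec[OF Cpos C0(2)]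
  have "((\<lambda>q. C_vec j q \<bullet> C_vec j q) has_derivative (\<lambda>u. 2 * (C_vec j p \<bullet> C' u))) (at p)"
    by (rule has_derivative_eq_rhs[OF has_derivative_inner[OF C C]])
      (simp add: fun_eq_iff inner_commute)
  note CC = this
  have "1 - C_vec j p \<bullet> C_vec j p / (Lam j p)\<^sup>2 > 0"
    using e1(1) by (simp add: power2_norm_eq_inner)
  then have "\<exists>e'. (ecc j has_derivative e') (at p)"
    unfolding ecc_def[abs_def] power2_norm_eq_inner
    using Lp by (intro exI) (rule derivative_intros CC coordinate_has_derivative | simp)+
  then obtain e' where e': "(ecc j has_derivative e') (at p)" ..
  define z' where "z' = (\<lambda>u. (ell j u + sin (zeta j p) * e' u) / (1 - ecc j p * cos (zeta j p)))"
  have z': "(zeta j has_derivative z') (at p)"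
    unfolding z'_def zeta_eq_kepler[abs_def]
    by (rule has_derivative_kepler[OF e' coordinate_has_derivative(6) e1(2)]) simp
  have l: "ell j u = z' u * (1 - ecc j p * cos (zeta j p)) - e' u * sin (zeta j p)" for u
    using one_minus_e_cos_pos[OF e1(2), of "zeta j p"] by (simp add: z'_def)
  obtain \<alpha> \<beta> \<gamma> \<delta> where abcd:
    "((\<lambda>q. (Lam j q)\<^sup>2 / K * (cos (zeta j q) - ecc j q)) has_derivative \<alpha>) (at p)"
    "((\<lambda>q. (Lam j q)\<^sup>2 / K * sqrt (1 - (ecc j q)\<^sup>2) * sin (zeta j q)) has_derivative \<beta>) (at p)"
    "((\<lambda>q. - (K / Lam j q) * (sin (zeta j q) / (1 - ecc j q * cos (zeta j q)))) has_derivative \<gamma>) (at p)"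
    "((\<lambda>q. K / Lam j q * sqrt (1 - (ecc j q)\<^sup>2) * (cos (zeta j q) / (1 - ecc j q * cos (zeta j q))))
      has_derivative \<delta>) (at p)"
    and planar: "\<And>u v. \<gamma> u * \<alpha> v - \<gamma> v * \<alpha> u + (\<delta> u * \<beta> v - \<delta> v * \<beta> u)
      = Lam j u * ell j v - Lam j v * ell j u"
    using planar_kepler_wedge[OF coordinate_has_derivative(3) e' z' less_imp_neq[OF Lp, symmetric]
        less_imp_neq[OF K, symmetric] e1(2) l] by blast
  have Peri': "(Peri j has_derivative (\<lambda>u. cross3 (\<Omega> u) (Peri j p))) (at p)"
    using A unfolding spins_def Peri_def[abs_def] by blast
  have Peri1: "norm (Peri j q) = 1" for q
    by (simp add: Peri_def norm_orthogonal_matrix TS_prod_orthogonal norm_k3)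
  have "C_vec j p \<bullet> C_vec j p > 0" using C0 by simp
  then have "\<exists>N'. (N_vec j has_derivative N') (at p)"
    unfolding N_vec_def[abs_def] norm_eq_sqrt_inner
    by (intro exI) (rule derivative_intros CC C | simp)+
  then obtain N' where N': "(N_vec j has_derivative N') (at p)" ..
  have N1: "\<forall>\<^sub>F q in nhds p. norm (N_vec j q) = 1"
    using evC by eventually_elim (simp add: N_vec_def)
  have NP: "\<forall>\<^sub>F q in nhds p. N_vec j q \<bullet> Peri j q = 0"
    using CP by eventually_elim (simp add: N_vec_def)
  \<comment> \<open>\<open>TS_prod j\<close> carries the perihelion direction but not the normal;
    the orbital frame turns relative to it at some rate \<open>\<rho>\<close> about the
    perihelion.\<close>
  obtain \<rho> where \<rho>: "N' = (\<lambda>u. cross3 (\<Omega> u + \<rho> u *\<^sub>R Peri j p) (N_vec j p))"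
    using spinning_frame[OF Peri' N' Peri1 N1 NP] by blast
  define \<omega> where "\<omega> = (\<lambda>u. \<Omega> u + \<rho> u *\<^sub>R Peri j p)"
  have N'_eq: "N' u = cross3 (\<omega> u) (N_vec j p)" for u
    by (simp add: \<rho> \<omega>_def)
  have P\<omega>: "(Peri j has_derivative (\<lambda>u. cross3 (\<omega> u) (Peri j p))) (at p)"
    using Peri' by (simp add: \<omega>_def cross_add_left cross_mult_left)
  have Q\<omega>: "(Q_vec j has_derivative (\<lambda>u. cross3 (\<omega> u) (Q_vec j p))) (at p)"
    unfolding Q_vec_def[abs_def]
  proof (rule has_derivative_eq_rhs[OF bounded_bilinear.FDERIV[OF bounded_bilinear_cross3 N' P\<omega>]], rule ext)
    show "cross3 (N_vec j p) (cross3 (\<omega> u) (Peri j p)) + cross3 (N' u) (Peri j p)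
        = cross3 (\<omega> u) (cross3 (N_vec j p) (Peri j p))" for u
      unfolding N'_eq by (simp add: Lagrange cross_skew[of "cross3 (\<omega> u) (N_vec j p)" "Peri j p"] inner_commute)
  qed
  have Np: "N_vec j p \<bullet> N_vec j p = 1" "N_vec j p \<bullet> Peri j p = 0" "Peri j p \<bullet> Peri j p = 1"
    using eventually_nhds_x_imp_x[OF N1] eventually_nhds_x_imp_x[OF NP] Peri1[of p]
    by (simp_all add: norm_eq_1)
  have on: "Peri j p \<bullet> Peri j p = 1" "Q_vec j p \<bullet> Q_vec j p = 1" "Peri j p \<bullet> Q_vec j p = 0"
    using norm_cross_dot[of "N_vec j p" "Peri j p"] Np
    by (simp_all add: Q_vec_def dot_cross_self power_mult_distrib power2_norm_eq_inner)
  have x_eq: "x_P m M j q = ((Lam j q)\<^sup>2 / K * (cos (zeta j q) - ecc j q)) *\<^sub>R Peri j q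
      + ((Lam j q)\<^sup>2 / K * sqrt (1 - (ecc j q)\<^sup>2) * sin (zeta j q)) *\<^sub>R Q_vec j q" for q
    using m M by (simp add: x_P_def Let_def semi_axis_def K_def power_divide)
  \<comment> \<open>Removing the square root of a square needs \<open>Lam j q > 0\<close>, so this
    formula for the momentum is used near \<open>p\<close> only.\<close>
  have y_eq: "(- (K / Lam j q) * (sin (zeta j q) / (1 - ecc j q * cos (zeta j q)))) *\<^sub>R Peri j q
      + (K / Lam j q * sqrt (1 - (ecc j q)\<^sup>2) * (cos (zeta j q) / (1 - ecc j q * cos (zeta j q))))
        *\<^sub>R Q_vec j q = y_P m M j q" if "Lam j q > 0" for q
  proof -
    have "M j / semi_axis m M j q = (M j * m j / Lam j q)\<^sup>2"
      using m M that by (simp add: semi_axis_def field_simps power2_eq_square)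
    then have "sqrt (M j / semi_axis m M j q) = M j * m j / Lam j q"
      using m M that by (simp only: real_sqrt_abs) simp
    then have s: "m j * sqrt (M j / semi_axis m M j q) = K / Lam j q"
      using m M that by (simp add: K_def power2_eq_square)
    have "m j * sqrt (M j * (1 - (ecc j q)\<^sup>2) / semi_axis m M j q)
        = m j * sqrt (M j / semi_axis m M j q) * sqrt (1 - (ecc j q)\<^sup>2)"
      by (simp flip: real_sqrt_mult)
    then show ?thesis by (simp add: y_P_def Let_def s)
  qed
  have evC_eq: "\<forall>\<^sub>F q in nhds p. C_vec j q =
      cross3 (((Lam j q)\<^sup>2 / K * (cos (zeta j q) - ecc j q)) *\<^sub>R Peri j q
          + ((Lam j q)\<^sup>2 / K * sqrt (1 - (ecc j q)\<^sup>2) * sin (zeta j q)) *\<^sub>R Q_vec j q)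
        ((- (K / Lam j q) * (sin (zeta j q) / (1 - ecc j q * cos (zeta j q)))) *\<^sub>R Peri j q
          + (K / Lam j q * sqrt (1 - (ecc j q)\<^sup>2) * (cos (zeta j q) / (1 - ecc j q * cos (zeta j q))))
            *\<^sub>R Q_vec j q)"
    using evC evL CP
  proof eventually_elim
    case (elim q)
    note e = ecc_of_norm_C_vec[OF elim(1,2)]
    have L: "0 < Lam j q" using elim norm_ge_zero[of "C_vec j q"] by linarith
    show ?case
      unfolding Q_vec_def using elim Peri1[of q] K e
      by (intro angular_momentum_in_orbital_frame[symmetric] L) (auto simp: N_vec_def)
  qed
  obtain x y where x: "(x_P m M j has_derivative x) (at p)"
    and y: "((\<lambda>q. (- (K / Lam j q) * (sin (zeta j q) / (1 - ecc j q * cos (zeta j q)))) *\<^sub>R Peri j q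
      + (K / Lam j q * sqrt (1 - (ecc j q)\<^sup>2) * (cos (zeta j q) / (1 - ecc j q * cos (zeta j q))))
        *\<^sub>R Q_vec j q) has_derivative y) (at p)"
    and xy: "\<And>u v. y u \<bullet> x v - y v \<bullet> x u = \<gamma> u * \<alpha> v - \<gamma> v * \<alpha> u + (\<delta> u * \<beta> v - \<delta> v * \<beta> u)
      + spin_form \<omega> (C_vec j p) C' u v"
    using wedge_spinning_frame[OF P\<omega> Q\<omega> on abcd C evC_eq] unfolding x_eq[symmetric] by blast
  \<comment> \<open>The component of the angular momentum along the perihelion is zero near
    \<open>p\<close>, so the rate \<open>\<rho>\<close> drops out and \<open>\<omega>\<close> may be
    replaced by \<open>\<Omega>\<close>.\<close>
  have "((\<lambda>q. Peri j q \<bullet> C_vec j q) has_derivative (\<lambda>u. 0)) (at p)"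
    by (rule has_derivative_transform_nhds[OF has_derivative_const[of 0]])
      (use CP in \<open>auto elim!: eventually_mono simp: inner_commute\<close>)
  from spin_form_add_axis[OF Peri' C this]
  have "spin_form \<omega> (C_vec j p) C' u v = spin_form \<Omega> (C_vec j p) C' u v" for u v
    unfolding \<omega>_def by simp
  moreover have "(y_P m M j has_derivative y) (at p)"
    by (rule has_derivative_transform_nhds[OF y
        eventually_mono[OF order_tendstoD(1)[OF coordinate_tendsto(3) Lp] y_eq]])
  ultimately show thesis
    using that[OF x] xy planar by simp
qed

text \<open>The angular momenta \<open>partial_C j\<close> and \<open>partial_C (Suc j)\<close> have
  the same component \<open>Theta (Suc j)\<close> along the perihelion, by the choice of the
  inclinations on either side of it; their difference is \<open>C_vec (Suc j)\<close>. At the last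
  body both components are 0, so \<open>lt'\<close> asks nothing there.\<close>

lemma C_vec_inner_Peri:
  fixes q :: "'n::finite point"
  assumes j: "j < CARD('n)" and lt: "\<bar>Theta (Suc j) q\<bar> < chi j q"
    and lt': "Suc j < CARD('n) \<Longrightarrow> \<bar>Theta (Suc j) q\<bar> < chi (Suc j) q"
  shows "C_vec (Suc j) q \<bullet> Peri (Suc j) q = 0"
proof -
  have orth: "orthogonal_matrix (TS_prod j q ** T_mat (Suc j) q)"
    by (simp add: orthogonal_matrix_mul TS_prod_orthogonal T_mat_orthogonal)
  have "partial_C j q \<bullet> Peri (Suc j) q = chi j q * (k3 \<bullet> (S_mat (Suc j) q *v k3))"
    by (simp add: partial_C_def Peri_def inner_orthogonal_matrix orth flip: matrix_vector_mul_assoc[of _ "S_mat _ _"])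
  also have "\<dots> = Theta (Suc j) q"
    by (simp add: S_mat_eq k3_inner_R3_R1 chi_cos_inclination lt)
  finally have 1: "partial_C j q \<bullet> Peri (Suc j) q = Theta (Suc j) q" .
  have 2: "partial_C (Suc j) q \<bullet> Peri (Suc j) q = Theta (Suc j) q"
  proof (cases "Suc j = CARD('n)")
    case True
    then show ?thesis by (simp add: partial_C_def chi_CARD Theta_CARD)
  next
    case False
    with j lt' have "\<bar>Theta (Suc j) q\<bar> < chi (Suc j) q" by auto
    then show ?thesis
      by (simp add: partial_C_def Peri_def inner_orthogonal_matrix TS_prod_orthogonal T_mat_eq
          k3_inner_R3_R1 chi_cos_inclination inner_commute[of _ k3] del: TS_prod.simps flip: matrix_vector_mul_assoc[of "TS_prod _ _"])
  qed
  show ?thesis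
    using j by (simp add: C_vec_eq_partial_C_diff inner_diff_left 1 2)
qed

section \<open>Summation over the bodies\<close>

theorem theorem2p8:
  fixes m M :: "nat \<Rightarrow> real"
  assumes "\<forall>j\<in>{1..CARD('n)}. 0 < m j" and "\<forall>j\<in>{1..CARD('n)}. 0 < M j"
  shows "\<forall>p \<in> (P_dom :: 'n::finite point set).
    P_map m M differentiable (at p) \<and>
    (\<forall>u v.
      (\<Sum>j = 1..CARD('n).
        wedge3 (\<lambda>q. entry (fst (P_map m M q)) (j - 1))
               (\<lambda>q. entry (snd (P_map m M q)) (j - 1)) p u v)
      = (\<Sum>i = 1..CARD('n).
          wedge (d_form (Theta (i - 1))) (d_form (vtheta (i - 1))) p u v
        + wedge (d_form (chi (i - 1))) (d_form (kappa (i - 1))) p u v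
        + wedge (d_form (Lam i)) (d_form (ell i)) p u v))"
proof (intro ballI conjI allI)
  fix p :: "'n point"
  assume p: "p \<in> P_dom"
  let ?n = "CARD('n)"
  \<comment> \<open>One derivative of \<open>partial_C j\<close> must serve both neighbouring
    bodies, so it is packed with the step identity before choosing. The range includes
    \<open>j = n\<close>, where \<open>partial_C\<close> vanishes and no step follows.\<close>
  define is_deriv where "is_deriv j W \<longleftrightarrow> (partial_C j has_derivative W) (at p) \<and> (j < ?n \<longrightarrow>
      (\<forall>u v. spin_form (angular_velocity (Suc j) p) (partial_C j p) W u v
        = spin_form (angular_velocity j p) (partial_C j p) W u v
          + (Theta j u * vtheta j v - Theta j v * vtheta j u)
          + (chi j u * kappa j v - chi j v * kappa j u)))" for j W
  have "\<exists>W. is_deriv j W" if "j \<le> ?n" for j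
  proof (cases "j = ?n")
    case True
    have "(partial_C j :: 'n point \<Rightarrow> _) = (\<lambda>q. 0)"
      by (simp add: fun_eq_iff partial_C_def True chi_CARD)
    then show ?thesis
      unfolding is_deriv_def using True by (auto intro: has_derivative_const)
  next
    case False
    then have "j < ?n" using that by simp
    from TS_prod_step[OF p this TS_prod_spins[OF p that]] show ?thesis
      unfolding is_deriv_def by metis
  qed
  then obtain W where "\<And>j. j \<le> ?n \<Longrightarrow> is_deriv j (W j)"
    by metis
  then have W: "\<And>j. j \<le> ?n \<Longrightarrow> (partial_C j has_derivative W j) (at p)"
    and step: "\<And>j u v. j < ?n \<Longrightarrow>
      spin_form (angular_velocity (Suc j) p) (partial_C j p) (W j) u v
        = spin_form (angular_velocity j p) (partial_C j p) (W j) u v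
          + (Theta j u * vtheta j v - Theta j v * vtheta j u)
          + (chi j u * kappa j v - chi j v * kappa j u)"
    unfolding is_deriv_def by (blast, metis less_imp_le)
  \<comment> \<open>The angular momentum is split into two \<open>partial_C\<close> terms, both
    still paired with the same angular velocity, that of index \<open>Suc j\<close>.\<close>
  define is_body_deriv where "is_body_deriv j x y \<longleftrightarrow>
      (x_P m M (Suc j) has_derivative x) (at p) \<and> (y_P m M (Suc j) has_derivative y) (at p) \<and>
      (\<forall>u v. y u \<bullet> x v - y v \<bullet> x u = Lam (Suc j) u * ell (Suc j) v - Lam (Suc j) v * ell (Suc j) u
        + (spin_form (angular_velocity (Suc j) p) (partial_C j p) (W j) u v
          - spin_form (angular_velocity (Suc j) p) (partial_C (Suc j) p) (W (Suc j)) u v))" for j x y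
  have "\<exists>x y. is_body_deriv j x y" if j: "j < ?n" for j
  proof -
    have Suc_j: "Suc j \<in> {1..?n}" using j by simp
    have C: "(C_vec (Suc j) has_derivative (\<lambda>u. W j u - W (Suc j) u)) (at p)"
      using j unfolding C_vec_eq_partial_C_diff[OF Suc_leI[OF j], abs_def]
      by (intro has_derivative_diff W) auto
    have "\<forall>\<^sub>F q in nhds p. Suc j < ?n \<longrightarrow> \<bar>Theta (Suc j) q\<bar> < chi (Suc j) q"
      using eventually_abs_Theta_less[OF P_dom_abs_Theta_less(1)[OF p, of "Suc j"]]
      by (cases "Suc j < ?n") auto
    with eventually_abs_Theta_less[OF P_dom_abs_Theta_less(2)[OF p j]]
    have CP: "\<forall>\<^sub>F q in nhds p. C_vec (Suc j) q \<bullet> Peri (Suc j) q = 0"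
      by eventually_elim (use j in \<open>auto intro: C_vec_inner_Peri\<close>)
    obtain x y where "(x_P m M (Suc j) has_derivative x) (at p)" "(y_P m M (Suc j) has_derivative y) (at p)"
      "\<And>u v. y u \<bullet> x v - y v \<bullet> x u = Lam (Suc j) u * ell (Suc j) v - Lam (Suc j) v * ell (Suc j) u
        + spin_form (angular_velocity (Suc j) p) (C_vec (Suc j) p) (\<lambda>u. W j u - W (Suc j) u) u v"
      by (rule body_has_derivative[where m = m and M = M, OF p Suc_j assms(1)[rule_format, OF Suc_j]
          assms(2)[rule_format, OF Suc_j] C CP TS_prod_spins[OF p Suc_leI[OF j]]])
        (rule that)
    then have "is_body_deriv j x y"
      unfolding C_vec_eq_partial_C_diff[OF Suc_leI[OF j]] spin_form_diff is_body_deriv_def by simp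
    then show ?thesis by blast
  qed
  then have "\<forall>j. \<exists>x y. j < ?n \<longrightarrow> is_body_deriv j x y"
    by blast
  then obtain x y where "\<And>j. j < ?n \<Longrightarrow> is_body_deriv j (x j) (y j)"
    unfolding choice_iff by blast
  then have x: "\<And>j. j < ?n \<Longrightarrow> (x_P m M (Suc j) has_derivative x j) (at p)"
    and y: "\<And>j. j < ?n \<Longrightarrow> (y_P m M (Suc j) has_derivative y j) (at p)"
    and xy: "\<And>j u v. j < ?n \<Longrightarrow> y j u \<bullet> x j v - y j v \<bullet> x j u =
      Lam (Suc j) u * ell (Suc j) v - Lam (Suc j) v * ell (Suc j) u
        + (spin_form (angular_velocity (Suc j) p) (partial_C j p) (W j) u v
          - spin_form (angular_velocity (Suc j) p) (partial_C (Suc j) p) (W (Suc j)) u v)"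
    unfolding is_body_deriv_def by blast+
  have idx: "to_nat_on UNIV k < ?n" for k :: 'n
    using bij_betwE[OF to_nat_on_finite[of "UNIV :: 'n set"]] by simp
  have "((\<lambda>q. \<chi> k. y_P m M (Suc (to_nat_on UNIV k)) q) has_derivative
      (\<lambda>u. \<chi> k :: 'n. y (to_nat_on UNIV k) u)) (at p)"
    "((\<lambda>q. \<chi> k. x_P m M (Suc (to_nat_on UNIV k)) q) has_derivative
      (\<lambda>u. \<chi> k :: 'n. x (to_nat_on UNIV k) u)) (at p)"
    by (rule has_derivative_vec_componentwise, simp add: x y idx)+
  from has_derivative_Pair[OF this] show "P_map m M differentiable (at p)"
    unfolding P_map_def[abs_def] differentiable_def by blast
  fix u v
  have wedge3: "wedge3 (\<lambda>q. entry (fst (P_map m M q)) (Suc j - 1))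
      (\<lambda>q. entry (snd (P_map m M q)) (Suc j - 1)) p u v = y j u \<bullet> x j v - y j v \<bullet> x j u"
    if j: "j < ?n" for j
  proof -
    have Suc_j: "Suc j \<in> {1..?n}" using j by simp
    have "d_form (\<lambda>q. f q $ k) p = (\<lambda>u. f' u $ k)" if "(f has_derivative f') (at p)"
      for f :: "'n point \<Rightarrow> real ^ 3" and f' k
      unfolding d_form_def
      by (rule frechet_derivative_at[OF bounded_linear.has_derivative[OF bounded_linear_vec_nth that], symmetric])
    from this[OF x[OF j]] this[OF y[OF j]] show ?thesis
      by (simp only: wedge3_def wedge_def entry_P_map[OF Suc_j] inner_vec_def inner_real_def
          sum_subtractf)
  qed
  \<comment> \<open>Here index \<open>j\<close> is used for both factors. The step identity turns
    the first term of body \<open>j + 1\<close> into \<open>F j\<close> plus two canonical pairs,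
    and its second term is \<open>F (Suc j)\<close>. The ends vanish: the angular velocity is 0 at
    \<open>j = 0\<close>, and \<open>partial_C\<close> is identically 0 at
    \<open>j = n\<close>.\<close>
  define F where "F j = spin_form (angular_velocity j p) (partial_C j p) (W j) u v" for j
  have F: "F 0 = 0" "F ?n = 0"
  proof -
    have "(partial_C ?n :: 'n point \<Rightarrow> _) = (\<lambda>q. 0)"
      by (simp add: fun_eq_iff partial_C_def chi_CARD)
    then have "W ?n = (\<lambda>u. 0)"
      using has_derivative_unique[OF W[of ?n]] by (metis has_derivative_const le_refl)
    then show "F ?n = 0" by (simp add: F_def spin_form_def partial_C_def chi_CARD)
    show "F 0 = 0" by (simp add: F_def spin_form_def)
  qed
  have summands: "(\<Sum>j<?n. wedge3 (\<lambda>q. entry (fst (P_map m M q)) (Suc j - 1))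
        (\<lambda>q. entry (snd (P_map m M q)) (Suc j - 1)) p u v) =
      (\<Sum>j<?n. wedge (d_form (Theta j)) (d_form (vtheta j)) p u v
        + wedge (d_form (chi j)) (d_form (kappa j)) p u v
        + wedge (d_form (Lam (Suc j))) (d_form (ell (Suc j))) p u v + (F j - F (Suc j)))"
  proof (rule sum.cong[OF refl])
    fix j assume "j \<in> {..<?n}"
    then have j: "j < ?n" by simp
    show "wedge3 (\<lambda>q. entry (fst (P_map m M q)) (Suc j - 1))
        (\<lambda>q. entry (snd (P_map m M q)) (Suc j - 1)) p u v =
      wedge (d_form (Theta j)) (d_form (vtheta j)) p u v
        + wedge (d_form (chi j)) (d_form (kappa j)) p u v
        + wedge (d_form (Lam (Suc j))) (d_form (ell (Suc j))) p u v + (F j - F (Suc j))"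
      unfolding wedge3[OF j] xy[OF j] step[OF j]
      by (simp add: wedge_def d_form_coordinate F_def)
  qed
  have "(\<Sum>j<?n. F j - F (Suc j)) = 0"
    using sum_lessThan_telescope'[of F ?n] F by simp
  moreover have shift: "(\<Sum>j = 1..?n. f j) = (\<Sum>j<?n. f (Suc j))" for f :: "nat \<Rightarrow> real"
    by (simp add: sum.atLeast1_atMost_eq)
  ultimately show "(\<Sum>j = 1..?n.
        wedge3 (\<lambda>q. entry (fst (P_map m M q)) (j - 1))
               (\<lambda>q. entry (snd (P_map m M q)) (j - 1)) p u v)
      = (\<Sum>i = 1..?n.
          wedge (d_form (Theta (i - 1))) (d_form (vtheta (i - 1))) p u v
        + wedge (d_form (chi (i - 1))) (d_form (kappa (i - 1))) p u v
        + wedge (d_form (Lam i)) (d_form (ell i)) p u v)"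
    unfolding shift summands
    by (simp add: sum.distrib)
qed

end
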